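(* Let $\underline{\mathsf{Cyl}}=(\mathsf{Cyl},i_0,i_1,p)$ be a cylinder in a formal category $\mathcal A$ equipped with a contraction structure $p$. Let $\underline{\mathsf{coCyl}}=(\mathsf{coCyl},e_0,e_1,c,v,\mathsf S,r_0,r_1,s,\Gamma_{ul})$ be a co-cylinder in $\mathcal A$ equipped with a contraction structure $c$, an involution structure $v$ compatible with $c$, a subdivision structure $(\mathsf S,r_0,r_1,s)$ compatible with $c$, and an upper left connection structure $\Gamma_{ul}$. Suppose that $\underline{\mathsf{Cyl}}$ is left adjoint to $\underline{\mathsf{coCyl}}$, and that the adjunction between $\mathsf{Cyl}$ and $\mathsf{coCyl}$ is compatible with $p$ and $c$. Let $j:a_0\to a_1$ be an arrow of $\mathcal A$ which is a trivial cofibration with respect to $\underline{\mathsf{Cyl}}$. Then $j$ admits a strong deformation retraction with respect to $\underline{\mathsf{Cyl}}$.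
   Context: Formal categories. Let $\mathcal C$ be a strict 2-category with a final object $1$. For an object $\mathcal A$ of $\mathcal C$, an object of $\mathcal A$ is a 1-arrow $1\to\mathcal A$ and an arrow of $\mathcal A$ is a 2-arrow between such; composition, commutative diagrams, pushouts and pullbacks in $\mathcal A$ are those of the category $\mathrm{Hom}_{\mathcal C}(1,\mathcal A)$. For 1-arrows $F,F_0,F_1:\mathcal A\to\mathcal A$, a 2-arrow $\eta:F_0\to F_1$, an object $a$ and an arrow $f$ of $\mathcal A$: $F(a)=F\circ a$, $F(f)$ is the whiskering of $F$ and $f$, $\eta(a):F_0(a)\to F_1(a)$ is the whiskering of $\eta$ and $a$; $F\cdot\eta$, $\eta\cdot F$ are whiskerings. Standing assumption: for all objects $\mathcal A_0,\mathcal A_1$ of $\mathcal C$ and objects $a$ of $\mathcal A_0$, evaluation at $a$ sends pushout (resp. pullback) squares of $\mathrm{Hom}_{\mathcal C}(\mathcal A_0,\mathcal A_1)$ to pushout (resp. pullback) squares of $\mathcal A_1$. (For $\mathcal C$ the 2-category of categories these are ordinary categories, functors and natural transformations.) $\mathcal A$ is a fixed object of $\mathcal C$. A cylinder in $\mathcal A$ is a 1-arrow $\mathsf{Cyl}:\mathcal A\to\mathcal A$ with 2-arrows $i_0,i_1:\mathrm{id}_{\mathcal A}\to\mathsf{Cyl}$; a contraction structure on it is a 2-arrow $p:\mathsf{Cyl}\to\mathrm{id}_{\mathcal A}$ with $pi_0=pi_1=\mathrm{id}$. A co-cylinder in $\mathcal A$ is a 1-arrow $\mathsf{coCyl}:\mathcal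 A\to\mathcal A$ with 2-arrows $e_0,e_1:\mathsf{coCyl}\to\mathrm{id}_{\mathcal A}$. Contraction: $c:\mathrm{id}_{\mathcal A}\to\mathsf{coCyl}$ with $e_0c=e_1c=\mathrm{id}$. Involution: $v:\mathsf{coCyl}\to\mathsf{coCyl}$ with $e_0v=e_1$, $e_1v=e_0$; compatible with $c$ if $vc=c$. Subdivision: a 1-arrow $\mathsf S:\mathcal A\to\mathcal A$, 2-arrows $r_0,r_1:\mathsf S\to\mathsf{coCyl}$ with $e_0r_0=e_1r_1$ a pullback square of $e_0$ and $e_1$ in $\mathrm{Hom}_{\mathcal C}(\mathcal A,\mathcal A)$, and $s:\mathsf S\to\mathsf{coCyl}$ with $e_0s=e_0r_1$, $e_1s=e_1r_0$; compatible with $c$ if $s\overline c=c$, where $\overline c:\mathrm{id}_{\mathcal A}\to\mathsf S$ is the unique 2-arrow with $r_0\overline c=r_1\overline c=c$. Upper left connection: $\Gamma_{ul}:\mathsf{coCyl}\to\mathsf{coCyl}^2$ with $(e_0\cdot\mathsf{coCyl})\Gamma_{ul}=(\mathsf{coCyl}\cdot e_0)\Gamma_{ul}=\mathrm{id}$, $(e_1\cdot\mathsf{coCyl})\Gamma_{ul}=(\mathsf{coCyl}\cdot e_1)\Gamma_{ul}=c\,e_1$. $\underline{\mathsf{Cyl}}$ is left adjoint to $\underline{\mathsf{coCyl}}$ if $\mathsf{Cyl}$ is left adjoint to $\mathsf{coCyl}$ in $\mathcal C$, with natural bijection $\mathsf{adj}:\mathrm{Hom}_{\mathcal A}(\mathsf{Cyl}(a_0),a_1)\to\mathrm{Hom}_{\mathcal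 A}(a_0,\mathsf{coCyl}(a_1))$, and $e_\epsilon(a_1)\circ\mathsf{adj}(h)=h\circ i_\epsilon(a_0)$ for $\epsilon=0,1$ and all $h$. The adjunction is compatible with $p$ and $c$ if $\mathsf{adj}(f\circ p(a_0))=c(a_1)\circ f$ for all $f:a_0\to a_1$. A homotopy from $f_0$ to $f_1$ ($f_0,f_1:a_0\to a_1$) with respect to $\underline{\mathsf{Cyl}}$ is $h:\mathsf{Cyl}(a_0)\to a_1$ with $h\circ i_0(a_0)=f_0$, $h\circ i_1(a_0)=f_1$. $f:a_0\to a_1$ is a homotopy equivalence if there are $f^{-1}:a_1\to a_0$ and homotopies from $f^{-1}f$ to $\mathrm{id}(a_0)$ and from $ff^{-1}$ to $\mathrm{id}(a_1)$. A cofibration with respect to $\underline{\mathsf{Cyl}}$ is $j:a_0\to a_1$ such that for all $f:a_1\to a_2$, $h:\mathsf{Cyl}(a_0)\to a_2$ with $h\circ i_0(a_0)=f\circ j$ there is $k:\mathsf{Cyl}(a_1)\to a_2$ with $k\circ\mathsf{Cyl}(j)=h$, $k\circ i_0(a_1)=f$. A trivial cofibration is an arrow that is both a cofibration and a homotopy equivalence with respect to $\underline{\mathsf{Cyl}}$. $j:a_0\to a_1$ admits a strong deformation retraction with respect to $\underline{\mathsf{Cyl}}$ if there is $f:a_1\to a_0$ with $fj=\mathrm{id}(a_0)$ and a homotopy $h:\mathsf{Cyl}(a_1)\to a_1$ from $jf$ to $\mathrm{id}(a_1)$ with $h\circ\mathsf{Cyl}(j)=j\circ p(a_0)$. *)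

theory Defs
  imports Main
begin

section \<open>Strict 2-categories\<close>

text \<open>
  \<open>G \<odot> F\<close> is composition of 1-arrows, \<open>\<beta> \<cdot> \<alpha>\<close> is vertical composition of 2-arrows
  and \<open>\<beta> \<star> \<alpha>\<close> is horizontal composition of 2-arrows. All three are written in the order of
  composition of functions. The operations are only constrained on composable arguments.
\<close>

record ('o, 'm, 'c) two_category =
  obj :: "'o set"
  arr1 :: "'m set"
  arr2 :: "'c set"
  src1 :: "'m \<Rightarrow> 'o"
  trg1 :: "'m \<Rightarrow> 'o"
  src2 :: "'c \<Rightarrow> 'm"
  trg2 :: "'c \<Rightarrow> 'm"
  id1 :: "'o \<Rightarrow> 'm"
  id2 :: "'m \<Rightarrow> 'c"
  comp1 :: "'m \<Rightarrow> 'm \<Rightarrow> 'm"  (infixl "\<odot>\<index>" 75)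
  vcomp :: "'c \<Rightarrow> 'c \<Rightarrow> 'c"  (infixl "\<cdot>\<index>" 70)
  hcomp :: "'c \<Rightarrow> 'c \<Rightarrow> 'c"  (infixl "\<star>\<index>" 75)

definition hom1 :: "('o, 'm, 'c, 'z) two_category_scheme \<Rightarrow> 'o \<Rightarrow> 'o \<Rightarrow> 'm set" where
  "hom1 C X Y = {F \<in> arr1 C. src1 C F = X \<and> trg1 C F = Y}"

definition hom2 :: "('o, 'm, 'c, 'z) two_category_scheme \<Rightarrow> 'm \<Rightarrow> 'm \<Rightarrow> 'c set" where
  "hom2 C F G = {\<alpha> \<in> arr2 C. src2 C \<alpha> = F \<and> trg2 C \<alpha> = G}"

locale strict_2_category =
  fixes C :: "('o, 'm, 'c, 'z) two_category_scheme" (structure)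
  assumes src1_obj: "F \<in> arr1 C \<Longrightarrow> src1 C F \<in> obj C"
    and trg1_obj: "F \<in> arr1 C \<Longrightarrow> trg1 C F \<in> obj C"
    and src2_arr1: "\<alpha> \<in> arr2 C \<Longrightarrow> src2 C \<alpha> \<in> arr1 C"
    and trg2_arr1: "\<alpha> \<in> arr2 C \<Longrightarrow> trg2 C \<alpha> \<in> arr1 C"
    and src1_parallel: "\<alpha> \<in> arr2 C \<Longrightarrow> src1 C (src2 C \<alpha>) = src1 C (trg2 C \<alpha>)"
    and trg1_parallel: "\<alpha> \<in> arr2 C \<Longrightarrow> trg1 C (src2 C \<alpha>) = trg1 C (trg2 C \<alpha>)"
    and id1_hom: "X \<in> obj C \<Longrightarrow> id1 C X \<in> hom1 C X X"
    and comp1_hom: "\<lbrakk>F \<in> hom1 C X Y; G \<in> hom1 C Y Z\<rbrakk> \<Longrightarrow> G \<odot> F \<in> hom1 C X Z"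
    and comp1_id_left: "F \<in> hom1 C X Y \<Longrightarrow> id1 C Y \<odot> F = F"
    and comp1_id_right: "F \<in> hom1 C X Y \<Longrightarrow> F \<odot> id1 C X = F"
    and comp1_assoc: "\<lbrakk>F \<in> hom1 C W X; G \<in> hom1 C X Y; H \<in> hom1 C Y Z\<rbrakk>
          \<Longrightarrow> (H \<odot> G) \<odot> F = H \<odot> (G \<odot> F)"
    and id2_hom: "F \<in> arr1 C \<Longrightarrow> id2 C F \<in> hom2 C F F"
    and vcomp_hom: "\<lbrakk>\<alpha> \<in> hom2 C F G; \<beta> \<in> hom2 C G H\<rbrakk> \<Longrightarrow> \<beta> \<cdot> \<alpha> \<in> hom2 C F H"
    and vcomp_id_left: "\<alpha> \<in> hom2 C F G \<Longrightarrow> id2 C G \<cdot> \<alpha> = \<alpha>"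
    and vcomp_id_right: "\<alpha> \<in> hom2 C F G \<Longrightarrow> \<alpha> \<cdot> id2 C F = \<alpha>"
    and vcomp_assoc: "\<lbrakk>\<alpha> \<in> hom2 C E F; \<beta> \<in> hom2 C F G; \<gamma> \<in> hom2 C G H\<rbrakk>
          \<Longrightarrow> (\<gamma> \<cdot> \<beta>) \<cdot> \<alpha> = \<gamma> \<cdot> (\<beta> \<cdot> \<alpha>)"
    and hcomp_hom: "\<lbrakk>F \<in> hom1 C X Y; G \<in> hom1 C X Y; H \<in> hom1 C Y Z; K \<in> hom1 C Y Z;
            \<alpha> \<in> hom2 C F G; \<beta> \<in> hom2 C H K\<rbrakk> \<Longrightarrow> \<beta> \<star> \<alpha> \<in> hom2 C (H \<odot> F) (K \<odot> G)"
    and hcomp_id_left: "\<lbrakk>F \<in> hom1 C X Y; \<alpha> \<in> hom2 C F G\<rbrakk> \<Longrightarrow> id2 C (id1 C Y) \<star> \<alpha> = \<alpha>"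
    and hcomp_id_right: "\<lbrakk>F \<in> hom1 C X Y; \<alpha> \<in> hom2 C F G\<rbrakk> \<Longrightarrow> \<alpha> \<star> id2 C (id1 C X) = \<alpha>"
    and hcomp_assoc: "\<lbrakk>F \<in> hom1 C W X; G \<in> hom1 C X Y; H \<in> hom1 C Y Z;
            \<alpha> \<in> hom2 C F F'; \<beta> \<in> hom2 C G G'; \<gamma> \<in> hom2 C H H'\<rbrakk>
          \<Longrightarrow> (\<gamma> \<star> \<beta>) \<star> \<alpha> = \<gamma> \<star> (\<beta> \<star> \<alpha>)"
    and hcomp_id2: "\<lbrakk>F \<in> hom1 C X Y; G \<in> hom1 C Y Z\<rbrakk> \<Longrightarrow> id2 C G \<star> id2 C F = id2 C (G \<odot> F)"
    and interchange: "\<lbrakk>F \<in> hom1 C X Y; K \<in> hom1 C Y Z;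
            \<alpha> \<in> hom2 C F G; \<beta> \<in> hom2 C G H; \<gamma> \<in> hom2 C K L; \<delta> \<in> hom2 C L M\<rbrakk>
          \<Longrightarrow> (\<delta> \<cdot> \<gamma>) \<star> (\<beta> \<cdot> \<alpha>) = (\<delta> \<star> \<beta>) \<cdot> (\<gamma> \<star> \<alpha>)"

definition whisker_left :: "('o, 'm, 'c, 'z) two_category_scheme \<Rightarrow> 'm \<Rightarrow> 'c \<Rightarrow> 'c"
    (infixl "\<rhd>\<index>" 75)
  where "F \<rhd>\<^bsub>C\<^esub> \<alpha> = id2 C F \<star>\<^bsub>C\<^esub> \<alpha>"

definition whisker_right :: "('o, 'm, 'c, 'z) two_category_scheme \<Rightarrow> 'c \<Rightarrow> 'm \<Rightarrow> 'c"
    (infixl "\<lhd>\<index>" 75)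
  where "\<alpha> \<lhd>\<^bsub>C\<^esub> F = \<alpha> \<star>\<^bsub>C\<^esub> id2 C F"

text \<open>
  Only the one-dimensional universal property of a final object is required; objects which are
  final in the stronger, two-dimensional sense satisfy it in particular.
\<close>

definition final_object :: "('o, 'm, 'c, 'z) two_category_scheme \<Rightarrow> 'o \<Rightarrow> bool" where
  "final_object C T \<longleftrightarrow> T \<in> obj C \<and> (\<forall>X \<in> obj C. \<exists>!F. F \<in> hom1 C X T)"

text \<open>
  Squares in the category of 1-arrows \<open>X \<rightarrow> Y\<close> and 2-arrows between them. In a pullback square
  \<open>f \<cdot> q0 = g \<cdot> q1\<close> the arrows \<open>q0\<close>, \<open>q1\<close> are the projections; in a pushout square
  \<open>q0 \<cdot> f = q1 \<cdot> g\<close> they are the coprojections.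
\<close>

definition pullback_square ::
    "('o, 'm, 'c, 'z) two_category_scheme \<Rightarrow> 'o \<Rightarrow> 'o \<Rightarrow> 'c \<Rightarrow> 'c \<Rightarrow> 'c \<Rightarrow> 'c \<Rightarrow> bool" where
  "pullback_square C X Y q0 q1 f g \<longleftrightarrow>
     (\<exists>P \<in> hom1 C X Y. \<exists>F \<in> hom1 C X Y. \<exists>G \<in> hom1 C X Y. \<exists>H \<in> hom1 C X Y.
        q0 \<in> hom2 C P F \<and> q1 \<in> hom2 C P G \<and> f \<in> hom2 C F H \<and> g \<in> hom2 C G H \<and>
        f \<cdot>\<^bsub>C\<^esub> q0 = g \<cdot>\<^bsub>C\<^esub> q1 \<and>
        (\<forall>T \<in> hom1 C X Y. \<forall>u \<in> hom2 C T F. \<forall>w \<in> hom2 C T G. f \<cdot>\<^bsub>C\<^esub> u = g \<cdot>\<^bsub>C\<^esub> w \<longrightarrow>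
           (\<exists>!k. k \<in> hom2 C T P \<and> q0 \<cdot>\<^bsub>C\<^esub> k = u \<and> q1 \<cdot>\<^bsub>C\<^esub> k = w)))"

definition pushout_square ::
    "('o, 'm, 'c, 'z) two_category_scheme \<Rightarrow> 'o \<Rightarrow> 'o \<Rightarrow> 'c \<Rightarrow> 'c \<Rightarrow> 'c \<Rightarrow> 'c \<Rightarrow> bool" where
  "pushout_square C X Y f g q0 q1 \<longleftrightarrow>
     (\<exists>H \<in> hom1 C X Y. \<exists>F \<in> hom1 C X Y. \<exists>G \<in> hom1 C X Y. \<exists>P \<in> hom1 C X Y.
        f \<in> hom2 C H F \<and> g \<in> hom2 C H G \<and> q0 \<in> hom2 C F P \<and> q1 \<in> hom2 C G P \<and>
        q0 \<cdot>\<^bsub>C\<^esub> f = q1 \<cdot>\<^bsub>C\<^esub> g \<and>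
        (\<forall>T \<in> hom1 C X Y. \<forall>u \<in> hom2 C F T. \<forall>w \<in> hom2 C G T. u \<cdot>\<^bsub>C\<^esub> f = w \<cdot>\<^bsub>C\<^esub> g \<longrightarrow>
           (\<exists>!k. k \<in> hom2 C P T \<and> k \<cdot>\<^bsub>C\<^esub> q0 = u \<and> k \<cdot>\<^bsub>C\<^esub> q1 = w)))"

definition adjunction ::
    "('o, 'm, 'c, 'z) two_category_scheme \<Rightarrow> 'o \<Rightarrow> 'o \<Rightarrow> 'm \<Rightarrow> 'm \<Rightarrow> 'c \<Rightarrow> 'c \<Rightarrow> bool" where
  "adjunction C X Y L R \<eta> \<epsilon> \<longleftrightarrow>
     L \<in> hom1 C X Y \<and> R \<in> hom1 C Y X \<and>
     \<eta> \<in> hom2 C (id1 C X) (R \<odot>\<^bsub>C\<^esub> L) \<and> \<epsilon> \<in> hom2 C (L \<odot>\<^bsub>C\<^esub> R) (id1 C Y) \<and>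
     (\<epsilon> \<lhd>\<^bsub>C\<^esub> L) \<cdot>\<^bsub>C\<^esub> (L \<rhd>\<^bsub>C\<^esub> \<eta>) = id2 C L \<and>
     (R \<rhd>\<^bsub>C\<^esub> \<epsilon>) \<cdot>\<^bsub>C\<^esub> (\<eta> \<lhd>\<^bsub>C\<^esub> R) = id2 C R"

text \<open>
  The bijection from arrows \<open>L \<odot> a \<rightarrow> b\<close> to arrows \<open>a \<rightarrow> R \<odot> b\<close> given by an adjunction with
  right adjoint \<open>R\<close> and unit \<open>\<eta>\<close>.
\<close>

definition adj :: "('o, 'm, 'c, 'z) two_category_scheme \<Rightarrow> 'm \<Rightarrow> 'c \<Rightarrow> 'm \<Rightarrow> 'c \<Rightarrow> 'c" where
  "adj C R \<eta> a h = (R \<rhd>\<^bsub>C\<^esub> h) \<cdot>\<^bsub>C\<^esub> (\<eta> \<lhd>\<^bsub>C\<^esub> a)"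


section \<open>Formal categories\<close>

text \<open>
  The objects of \<open>A\<close> are the elements of \<open>hom1 C T A\<close> with \<open>T\<close> the chosen final object, and the
  arrows \<open>a \<rightarrow> b\<close> of \<open>A\<close> are the elements of \<open>hom2 C a b\<close>. Thus \<open>F(a)\<close>, \<open>F(f)\<close> and \<open>\<eta>(a)\<close> are
  \<open>F \<odot> a\<close>, \<open>F \<rhd> f\<close> and \<open>\<eta> \<lhd> a\<close>.
\<close>

locale formal_category = strict_2_category C
  for C :: "('o, 'm, 'c, 'z) two_category_scheme" (structure) +
  fixes T :: 'o and A :: 'o
  assumes final: "final_object C T"
    and A_obj: "A \<in> obj C"
    and evaluation_pullback:
      "\<lbrakk>X \<in> obj C; Y \<in> obj C; a \<in> hom1 C T X; pullback_square C X Y q0 q1 f g\<rbrakk>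
         \<Longrightarrow> pullback_square C T Y (q0 \<lhd> a) (q1 \<lhd> a) (f \<lhd> a) (g \<lhd> a)"
    and evaluation_pushout:
      "\<lbrakk>X \<in> obj C; Y \<in> obj C; a \<in> hom1 C T X; pushout_square C X Y f g q0 q1\<rbrakk>
         \<Longrightarrow> pushout_square C T Y (f \<lhd> a) (g \<lhd> a) (q0 \<lhd> a) (q1 \<lhd> a)"


section \<open>Cylinders and co-cylinders\<close>

definition cylinder ::
    "('o, 'm, 'c, 'z) two_category_scheme \<Rightarrow> 'o \<Rightarrow> 'm \<Rightarrow> 'c \<Rightarrow> 'c \<Rightarrow> bool" where
  "cylinder C A Cyl i0 i1 \<longleftrightarrow>
     Cyl \<in> hom1 C A A \<and> i0 \<in> hom2 C (id1 C A) Cyl \<and> i1 \<in> hom2 C (id1 C A) Cyl"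

definition cyl_contraction ::
    "('o, 'm, 'c, 'z) two_category_scheme \<Rightarrow> 'o \<Rightarrow> 'm \<Rightarrow> 'c \<Rightarrow> 'c \<Rightarrow> 'c \<Rightarrow> bool" where
  "cyl_contraction C A Cyl i0 i1 p \<longleftrightarrow>
     p \<in> hom2 C Cyl (id1 C A) \<and>
     p \<cdot>\<^bsub>C\<^esub> i0 = id2 C (id1 C A) \<and> p \<cdot>\<^bsub>C\<^esub> i1 = id2 C (id1 C A)"

definition cocylinder ::
    "('o, 'm, 'c, 'z) two_category_scheme \<Rightarrow> 'o \<Rightarrow> 'm \<Rightarrow> 'c \<Rightarrow> 'c \<Rightarrow> bool" where
  "cocylinder C A coCyl e0 e1 \<longleftrightarrow>
     coCyl \<in> hom1 C A A \<and> e0 \<in> hom2 C coCyl (id1 C A) \<and> e1 \<in> hom2 C coCyl (id1 C A)"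

definition cocyl_contraction ::
    "('o, 'm, 'c, 'z) two_category_scheme \<Rightarrow> 'o \<Rightarrow> 'm \<Rightarrow> 'c \<Rightarrow> 'c \<Rightarrow> 'c \<Rightarrow> bool" where
  "cocyl_contraction C A coCyl e0 e1 c \<longleftrightarrow>
     c \<in> hom2 C (id1 C A) coCyl \<and>
     e0 \<cdot>\<^bsub>C\<^esub> c = id2 C (id1 C A) \<and> e1 \<cdot>\<^bsub>C\<^esub> c = id2 C (id1 C A)"

definition cocyl_involution ::
    "('o, 'm, 'c, 'z) two_category_scheme \<Rightarrow> 'm \<Rightarrow> 'c \<Rightarrow> 'c \<Rightarrow> 'c \<Rightarrow> bool" where
  "cocyl_involution C coCyl e0 e1 v \<longleftrightarrow>
     v \<in> hom2 C coCyl coCyl \<and> e0 \<cdot>\<^bsub>C\<^esub> v = e1 \<and> e1 \<cdot>\<^bsub>C\<^esub> v = e0"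

definition involution_compatible ::
    "('o, 'm, 'c, 'z) two_category_scheme \<Rightarrow> 'c \<Rightarrow> 'c \<Rightarrow> bool" where
  "involution_compatible C v c \<longleftrightarrow> v \<cdot>\<^bsub>C\<^esub> c = c"

definition cocyl_subdivision ::
    "('o, 'm, 'c, 'z) two_category_scheme \<Rightarrow> 'o \<Rightarrow> 'm \<Rightarrow> 'c \<Rightarrow> 'c \<Rightarrow> 'm \<Rightarrow> 'c \<Rightarrow> 'c \<Rightarrow> 'c \<Rightarrow> bool"
  where
  "cocyl_subdivision C A coCyl e0 e1 S r0 r1 s \<longleftrightarrow>
     S \<in> hom1 C A A \<and> r0 \<in> hom2 C S coCyl \<and> r1 \<in> hom2 C S coCyl \<and>
     pullback_square C A A r0 r1 e0 e1 \<and>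
     s \<in> hom2 C S coCyl \<and> e0 \<cdot>\<^bsub>C\<^esub> s = e0 \<cdot>\<^bsub>C\<^esub> r1 \<and> e1 \<cdot>\<^bsub>C\<^esub> s = e1 \<cdot>\<^bsub>C\<^esub> r0"

text \<open>
  The 2-arrow from the identity to \<open>S\<close> induced by \<open>c\<close>. It exists and is unique for a subdivision
  structure, by the pullback property and \<open>e0 \<cdot> c = e1 \<cdot> c\<close>.
\<close>

definition contraction_lift ::
    "('o, 'm, 'c, 'z) two_category_scheme \<Rightarrow> 'o \<Rightarrow> 'm \<Rightarrow> 'c \<Rightarrow> 'c \<Rightarrow> 'c \<Rightarrow> 'c" where
  "contraction_lift C A S r0 r1 c =
     (THE x. x \<in> hom2 C (id1 C A) S \<and> r0 \<cdot>\<^bsub>C\<^esub> x = c \<and> r1 \<cdot>\<^bsub>C\<^esub> x = c)"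

definition subdivision_compatible ::
    "('o, 'm, 'c, 'z) two_category_scheme \<Rightarrow> 'o \<Rightarrow> 'm \<Rightarrow> 'c \<Rightarrow> 'c \<Rightarrow> 'c \<Rightarrow> 'c \<Rightarrow> bool" where
  "subdivision_compatible C A S r0 r1 s c \<longleftrightarrow> s \<cdot>\<^bsub>C\<^esub> contraction_lift C A S r0 r1 c = c"

definition upper_left_connection ::
    "('o, 'm, 'c, 'z) two_category_scheme \<Rightarrow> 'm \<Rightarrow> 'c \<Rightarrow> 'c \<Rightarrow> 'c \<Rightarrow> 'c \<Rightarrow> bool" where
  "upper_left_connection C coCyl e0 e1 c \<Gamma> \<longleftrightarrow>
     \<Gamma> \<in> hom2 C coCyl (coCyl \<odot>\<^bsub>C\<^esub> coCyl) \<and>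
     (e0 \<lhd>\<^bsub>C\<^esub> coCyl) \<cdot>\<^bsub>C\<^esub> \<Gamma> = id2 C coCyl \<and>
     (coCyl \<rhd>\<^bsub>C\<^esub> e0) \<cdot>\<^bsub>C\<^esub> \<Gamma> = id2 C coCyl \<and>
     (e1 \<lhd>\<^bsub>C\<^esub> coCyl) \<cdot>\<^bsub>C\<^esub> \<Gamma> = c \<cdot>\<^bsub>C\<^esub> e1 \<and>
     (coCyl \<rhd>\<^bsub>C\<^esub> e1) \<cdot>\<^bsub>C\<^esub> \<Gamma> = c \<cdot>\<^bsub>C\<^esub> e1"

definition cyl_left_adjoint ::
    "('o, 'm, 'c, 'z) two_category_scheme \<Rightarrow> 'o \<Rightarrow> 'o \<Rightarrow> 'm \<Rightarrow> 'c \<Rightarrow> 'c \<Rightarrow> 'm \<Rightarrow> 'c \<Rightarrow> 'c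
       \<Rightarrow> 'c \<Rightarrow> 'c \<Rightarrow> bool" where
  "cyl_left_adjoint C T A Cyl i0 i1 coCyl e0 e1 \<eta> \<epsilon> \<longleftrightarrow>
     adjunction C A A Cyl coCyl \<eta> \<epsilon> \<and>
     (\<forall>a0 \<in> hom1 C T A. \<forall>a1 \<in> hom1 C T A. \<forall>h \<in> hom2 C (Cyl \<odot>\<^bsub>C\<^esub> a0) a1.
        (e0 \<lhd>\<^bsub>C\<^esub> a1) \<cdot>\<^bsub>C\<^esub> adj C coCyl \<eta> a0 h = h \<cdot>\<^bsub>C\<^esub> (i0 \<lhd>\<^bsub>C\<^esub> a0) \<and>
        (e1 \<lhd>\<^bsub>C\<^esub> a1) \<cdot>\<^bsub>C\<^esub> adj C coCyl \<eta> a0 h = h \<cdot>\<^bsub>C\<^esub> (i1 \<lhd>\<^bsub>C\<^esub> a0))"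

definition adjunction_compatible ::
    "('o, 'm, 'c, 'z) two_category_scheme \<Rightarrow> 'o \<Rightarrow> 'o \<Rightarrow> 'c \<Rightarrow> 'm \<Rightarrow> 'c \<Rightarrow> 'c \<Rightarrow> bool" where
  "adjunction_compatible C T A p coCyl c \<eta> \<longleftrightarrow>
     (\<forall>a0 \<in> hom1 C T A. \<forall>a1 \<in> hom1 C T A. \<forall>f \<in> hom2 C a0 a1.
        adj C coCyl \<eta> a0 (f \<cdot>\<^bsub>C\<^esub> (p \<lhd>\<^bsub>C\<^esub> a0)) = (c \<lhd>\<^bsub>C\<^esub> a1) \<cdot>\<^bsub>C\<^esub> f)"


section \<open>Homotopies and cofibrations\<close>

definition homotopy ::
    "('o, 'm, 'c, 'z) two_category_scheme \<Rightarrow> 'm \<Rightarrow> 'c \<Rightarrow> 'c \<Rightarrow> 'm \<Rightarrow> 'm \<Rightarrow> 'c \<Rightarrow> 'c \<Rightarrow> 'c \<Rightarrow> bool"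
  where
  "homotopy C Cyl i0 i1 a0 a1 f0 f1 h \<longleftrightarrow>
     h \<in> hom2 C (Cyl \<odot>\<^bsub>C\<^esub> a0) a1 \<and>
     h \<cdot>\<^bsub>C\<^esub> (i0 \<lhd>\<^bsub>C\<^esub> a0) = f0 \<and> h \<cdot>\<^bsub>C\<^esub> (i1 \<lhd>\<^bsub>C\<^esub> a0) = f1"

definition homotopy_equivalence ::
    "('o, 'm, 'c, 'z) two_category_scheme \<Rightarrow> 'm \<Rightarrow> 'c \<Rightarrow> 'c \<Rightarrow> 'm \<Rightarrow> 'm \<Rightarrow> 'c \<Rightarrow> bool" where
  "homotopy_equivalence C Cyl i0 i1 a0 a1 f \<longleftrightarrow>
     f \<in> hom2 C a0 a1 \<and>
     (\<exists>g \<in> hom2 C a1 a0.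
        (\<exists>h. homotopy C Cyl i0 i1 a0 a0 (g \<cdot>\<^bsub>C\<^esub> f) (id2 C a0) h) \<and>
        (\<exists>h. homotopy C Cyl i0 i1 a1 a1 (f \<cdot>\<^bsub>C\<^esub> g) (id2 C a1) h))"

definition cofibration ::
    "('o, 'm, 'c, 'z) two_category_scheme \<Rightarrow> 'o \<Rightarrow> 'o \<Rightarrow> 'm \<Rightarrow> 'c \<Rightarrow> 'm \<Rightarrow> 'm \<Rightarrow> 'c \<Rightarrow> bool" where
  "cofibration C T A Cyl i0 a0 a1 j \<longleftrightarrow>
     j \<in> hom2 C a0 a1 \<and>
     (\<forall>a2 \<in> hom1 C T A. \<forall>f \<in> hom2 C a1 a2. \<forall>h \<in> hom2 C (Cyl \<odot>\<^bsub>C\<^esub> a0) a2.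
        h \<cdot>\<^bsub>C\<^esub> (i0 \<lhd>\<^bsub>C\<^esub> a0) = f \<cdot>\<^bsub>C\<^esub> j \<longrightarrow>
        (\<exists>k \<in> hom2 C (Cyl \<odot>\<^bsub>C\<^esub> a1) a2.
           k \<cdot>\<^bsub>C\<^esub> (Cyl \<rhd>\<^bsub>C\<^esub> j) = h \<and> k \<cdot>\<^bsub>C\<^esub> (i0 \<lhd>\<^bsub>C\<^esub> a1) = f))"

definition trivial_cofibration ::
    "('o, 'm, 'c, 'z) two_category_scheme \<Rightarrow> 'o \<Rightarrow> 'o \<Rightarrow> 'm \<Rightarrow> 'c \<Rightarrow> 'c \<Rightarrow> 'm \<Rightarrow> 'm \<Rightarrow> 'c \<Rightarrow> bool"
  where
  "trivial_cofibration C T A Cyl i0 i1 a0 a1 j \<longleftrightarrow>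
     cofibration C T A Cyl i0 a0 a1 j \<and> homotopy_equivalence C Cyl i0 i1 a0 a1 j"

definition strong_deformation_retraction ::
    "('o, 'm, 'c, 'z) two_category_scheme \<Rightarrow> 'm \<Rightarrow> 'c \<Rightarrow> 'c \<Rightarrow> 'c \<Rightarrow> 'm \<Rightarrow> 'm \<Rightarrow> 'c \<Rightarrow> bool" where
  "strong_deformation_retraction C Cyl i0 i1 p a0 a1 j \<longleftrightarrow>
     (\<exists>f \<in> hom2 C a1 a0. f \<cdot>\<^bsub>C\<^esub> j = id2 C a0 \<and>
        (\<exists>h. homotopy C Cyl i0 i1 a1 a1 (j \<cdot>\<^bsub>C\<^esub> f) (id2 C a1) h \<and>
             h \<cdot>\<^bsub>C\<^esub> (Cyl \<rhd>\<^bsub>C\<^esub> j) = j \<cdot>\<^bsub>C\<^esub> (p \<lhd>\<^bsub>C\<^esub> a0)))"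

end

theory Submission
  imports Defs
begin

text \<open>
  Under the adjunction a homotopy becomes a path, that is, an arrow into the co-cylinder, and the
  homotopy extension property of \<open>j\<close> becomes a lifting property against \<open>e0\<close>. The proof is
  carried out on paths, where reversal and concatenation are available.

  A homotopy inverse \<open>g\<close> of \<open>j\<close> is first replaced by a strict retraction: lifting the path from
  \<open>g j\<close> to the identity gives a path from \<open>g\<close> to some \<open>f\<close> with \<open>f j = id\<close>, and a path \<open>D\<close> from
  \<open>j f\<close> to the identity results by concatenation (\<open>strict_retraction\<close>). The restriction \<open>D j\<close> is
  a path from \<open>j\<close> to \<open>j\<close> that need not be constant. The remedy is to precede \<open>D\<close> by the reverse of
  \<open>D j f\<close>, which is a path from \<open>j f\<close> to \<open>j f\<close>. The result \<open>Q\<close> has the same end points as \<open>D\<close>, and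
  restricts along \<open>j\<close> to a path \<open>R\<close> preceded by its own reverse, where \<open>R = D j\<close>. Such a
  concatenation can be contracted to a constant path with its end points fixed: the upper left
  connection gives a square with edge \<open>R\<close>, and this square glued to its mirror image is the
  required contraction (\<open>null_homotopy\<close>). Gluing squares along their sides requires that the
  co-cylinder preserves the pullback \<open>S\<close>, which it does because it is a right adjoint
  (\<open>right_adjoint_pair\<close>). Lifting the contraction along \<open>j\<close>, starting from \<open>Q\<close>, and travelling
  around the three remaining edges of the resulting square gives a path from \<open>j f\<close> to the identity
  which is constant on \<open>j\<close> (\<open>rectify_deformation\<close>): constant paths are preserved by reversal and
  concatenation, since both structures are compatible with \<open>c\<close>.
\<close>

section \<open>Categories with a path functor\<close>

text \<open>
  This is what a co-cylinder becomes after evaluation at the objects of a formal category: an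
  ordinary category with an endofunctor \<open>P\<close> and families of arrows indexed by objects.
  An arrow \<open>a \<rightarrow> P b\<close> is a path between arrows \<open>a \<rightarrow> b\<close>, and an arrow \<open>a \<rightarrow> P (P b)\<close> is a
  square with the four edges given by \<open>e0 (P b)\<close>, \<open>e1 (P b)\<close> (top and bottom) and \<open>Pm (e0 b)\<close>,
  \<open>Pm (e1 b)\<close> (left and right). The assumption \<open>PS_pair\<close> is the existence half of the statement that
  \<open>P\<close> preserves the pullback \<open>S b\<close>.
\<close>

locale path_category =
  fixes Ob :: "'m set"
    and Hom :: "'m \<Rightarrow> 'm \<Rightarrow> 'c set"
    and comp :: "'c \<Rightarrow> 'c \<Rightarrow> 'c"  (infixl "\<bullet>" 70)
    and one :: "'m \<Rightarrow> 'c"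
    and P :: "'m \<Rightarrow> 'm" and Pm :: "'c \<Rightarrow> 'c"
    and e0 e1 c v :: "'m \<Rightarrow> 'c"
    and S :: "'m \<Rightarrow> 'm" and r0 r1 s :: "'m \<Rightarrow> 'c"
    and \<Gamma> :: "'m \<Rightarrow> 'c"
  assumes comp_in: "\<lbrakk>f \<in> Hom x y; g \<in> Hom y z\<rbrakk> \<Longrightarrow> g \<bullet> f \<in> Hom x z"
    and comp_assoc: "\<lbrakk>f \<in> Hom t x; g \<in> Hom x y; h \<in> Hom y z\<rbrakk> \<Longrightarrow> (h \<bullet> g) \<bullet> f = h \<bullet> (g \<bullet> f)"
    and one_left: "f \<in> Hom x y \<Longrightarrow> one y \<bullet> f = f"
    and one_right: "f \<in> Hom x y \<Longrightarrow> f \<bullet> one x = f"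
    and P_Ob: "b \<in> Ob \<Longrightarrow> P b \<in> Ob"
    and Pm_in: "\<lbrakk>x \<in> Ob; y \<in> Ob; f \<in> Hom x y\<rbrakk> \<Longrightarrow> Pm f \<in> Hom (P x) (P y)"
    and Pm_comp: "\<lbrakk>x \<in> Ob; y \<in> Ob; z \<in> Ob; f \<in> Hom x y; g \<in> Hom y z\<rbrakk>
          \<Longrightarrow> Pm (g \<bullet> f) = Pm g \<bullet> Pm f"
    and e0_in: "b \<in> Ob \<Longrightarrow> e0 b \<in> Hom (P b) b"
    and e1_in: "b \<in> Ob \<Longrightarrow> e1 b \<in> Hom (P b) b"
    and c_in: "b \<in> Ob \<Longrightarrow> c b \<in> Hom b (P b)"
    and v_in: "b \<in> Ob \<Longrightarrow> v b \<in> Hom (P b) (P b)"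
    and e0_natural: "\<lbrakk>x \<in> Ob; y \<in> Ob; f \<in> Hom x y\<rbrakk> \<Longrightarrow> e0 y \<bullet> Pm f = f \<bullet> e0 x"
    and e1_natural: "\<lbrakk>x \<in> Ob; y \<in> Ob; f \<in> Hom x y\<rbrakk> \<Longrightarrow> e1 y \<bullet> Pm f = f \<bullet> e1 x"
    and e0_v: "b \<in> Ob \<Longrightarrow> e0 b \<bullet> v b = e1 b"
    and e1_v: "b \<in> Ob \<Longrightarrow> e1 b \<bullet> v b = e0 b"
    and v_c: "b \<in> Ob \<Longrightarrow> v b \<bullet> c b = c b"
    and S_Ob: "b \<in> Ob \<Longrightarrow> S b \<in> Ob"
    and r0_in: "b \<in> Ob \<Longrightarrow> r0 b \<in> Hom (S b) (P b)"
    and r1_in: "b \<in> Ob \<Longrightarrow> r1 b \<in> Hom (S b) (P b)"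
    and s_in: "b \<in> Ob \<Longrightarrow> s b \<in> Hom (S b) (P b)"
    and e0_s: "b \<in> Ob \<Longrightarrow> e0 b \<bullet> s b = e0 b \<bullet> r1 b"
    and e1_s: "b \<in> Ob \<Longrightarrow> e1 b \<bullet> s b = e1 b \<bullet> r0 b"
    and S_pair: "\<lbrakk>a \<in> Ob; b \<in> Ob; u \<in> Hom a (P b); w \<in> Hom a (P b); e0 b \<bullet> u = e1 b \<bullet> w\<rbrakk>
          \<Longrightarrow> \<exists>!k. k \<in> Hom a (S b) \<and> r0 b \<bullet> k = u \<and> r1 b \<bullet> k = w"
    and S_square: "b \<in> Ob \<Longrightarrow> e0 b \<bullet> r0 b = e1 b \<bullet> r1 b"
    and S_const: "b \<in> Ob \<Longrightarrow> \<exists>k \<in> Hom b (S b). r0 b \<bullet> k = c b \<and> r1 b \<bullet> k = c b \<and> s b \<bullet> k = c b"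
    and PS_pair: "\<lbrakk>a \<in> Ob; b \<in> Ob; u \<in> Hom a (P (P b)); w \<in> Hom a (P (P b));
            Pm (e0 b) \<bullet> u = Pm (e1 b) \<bullet> w\<rbrakk>
          \<Longrightarrow> \<exists>k \<in> Hom a (P (S b)). Pm (r0 b) \<bullet> k = u \<and> Pm (r1 b) \<bullet> k = w"
    and \<Gamma>_in: "b \<in> Ob \<Longrightarrow> \<Gamma> b \<in> Hom (P b) (P (P b))"
    and \<Gamma>_top: "b \<in> Ob \<Longrightarrow> e0 (P b) \<bullet> \<Gamma> b = one (P b)"
    and \<Gamma>_left: "b \<in> Ob \<Longrightarrow> Pm (e0 b) \<bullet> \<Gamma> b = one (P b)"
    and \<Gamma>_bottom: "b \<in> Ob \<Longrightarrow> e1 (P b) \<bullet> \<Gamma> b = c b \<bullet> e1 b"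
    and \<Gamma>_right: "b \<in> Ob \<Longrightarrow> Pm (e1 b) \<bullet> \<Gamma> b = c b \<bullet> e1 b"
begin

lemma comp_square:
  assumes "f \<bullet> g = f' \<bullet> g'" "x \<in> Hom w y" "g \<in> Hom y z" "f \<in> Hom z t" "g' \<in> Hom y z'" "f' \<in> Hom z' t"
  shows "f \<bullet> (g \<bullet> x) = f' \<bullet> (g' \<bullet> x)"
  using comp_assoc[OF assms(2,3,4)] comp_assoc[OF assms(2,5,6)] assms(1) by simp

lemma comp_collapse:
  assumes "f \<bullet> g = h" "x \<in> Hom w y" "g \<in> Hom y z" "f \<in> Hom z t"
  shows "f \<bullet> (g \<bullet> x) = h \<bullet> x"
  using comp_assoc[OF assms(2,3,4)] assms(1) by simp

lemma path_reverse:
  assumes "b \<in> Ob" "u \<in> Hom a (P b)"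
  shows "v b \<bullet> u \<in> Hom a (P b)" "e0 b \<bullet> (v b \<bullet> u) = e1 b \<bullet> u" "e1 b \<bullet> (v b \<bullet> u) = e0 b \<bullet> u"
  using comp_in[OF assms(2) v_in[OF assms(1)]]
    comp_collapse[OF e0_v[OF assms(1)] assms(2) v_in[OF assms(1)] e0_in[OF assms(1)]]
    comp_collapse[OF e1_v[OF assms(1)] assms(2) v_in[OF assms(1)] e1_in[OF assms(1)]] .

lemma reverse_const:
  assumes "b \<in> Ob" "y \<in> Hom a b"
  shows "v b \<bullet> (c b \<bullet> y) = c b \<bullet> y"
  using comp_collapse[OF v_c[OF assms(1)] assms(2) c_in[OF assms(1)] v_in[OF assms(1)]] .

text \<open>
  Concatenation is kept as a relation on paths. The path traversed first is the component \<open>r1\<close>,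
  because \<open>e0 s = e0 r1\<close> and \<open>e1 s = e1 r0\<close>.
\<close>

definition concatenates :: "'m \<Rightarrow> 'm \<Rightarrow> 'c \<Rightarrow> 'c \<Rightarrow> 'c \<Rightarrow> bool" where
  "concatenates a b u w q \<longleftrightarrow> (\<exists>k \<in> Hom a (S b). r1 b \<bullet> k = u \<and> r0 b \<bullet> k = w \<and> q = s b \<bullet> k)"

lemma concatenates_exists:
  assumes "a \<in> Ob" "b \<in> Ob" "u \<in> Hom a (P b)" "w \<in> Hom a (P b)" "e1 b \<bullet> u = e0 b \<bullet> w"
  obtains q where "concatenates a b u w q"
  using S_pair[OF assms(1,2,4,3) assms(5)[symmetric]] unfolding concatenates_def by blast

lemma concatenates_path:
  assumes "b \<in> Ob" "concatenates a b u w q"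
  shows "q \<in> Hom a (P b)" "e0 b \<bullet> q = e0 b \<bullet> u" "e1 b \<bullet> q = e1 b \<bullet> w"
proof -
  obtain k where k: "k \<in> Hom a (S b)" "r1 b \<bullet> k = u" "r0 b \<bullet> k = w" "q = s b \<bullet> k"
    using assms(2) unfolding concatenates_def by blast
  show "q \<in> Hom a (P b)" using k comp_in s_in assms(1) by blast
  show "e0 b \<bullet> q = e0 b \<bullet> u"
    using comp_square[OF e0_s k(1) s_in e0_in r1_in e0_in] assms(1) k by simp
  show "e1 b \<bullet> q = e1 b \<bullet> w"
    using comp_square[OF e1_s k(1) s_in e1_in r0_in e1_in] assms(1) k by simp
qed

lemma concatenates_precomp:
  assumes "b \<in> Ob" "concatenates a b u w q" "x \<in> Hom a' a"
  shows "concatenates a' b (u \<bullet> x) (w \<bullet> x) (q \<bullet> x)"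
proof -
  obtain k where k: "k \<in> Hom a (S b)" "r1 b \<bullet> k = u" "r0 b \<bullet> k = w" "q = s b \<bullet> k"
    using assms(2) unfolding concatenates_def by blast
  note assoc = comp_assoc[OF assms(3) k(1)]
  show ?thesis unfolding concatenates_def
    using assoc[OF r0_in[OF assms(1)]] assoc[OF r1_in[OF assms(1)]] assoc[OF s_in[OF assms(1)]]
      k comp_in[OF assms(3) k(1)]
    by (intro bexI[of _ "k \<bullet> x"]) auto
qed

lemma concatenates_unique:
  assumes "a \<in> Ob" "b \<in> Ob" "concatenates a b u w q" "concatenates a b u w q'"
  shows "q = q'"
proof -
  obtain k where k: "k \<in> Hom a (S b)" "r1 b \<bullet> k = u" "r0 b \<bullet> k = w" "q = s b \<bullet> k"
    using assms(3) unfolding concatenates_def by blast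
  obtain k' where k': "k' \<in> Hom a (S b)" "r1 b \<bullet> k' = u" "r0 b \<bullet> k' = w" "q' = s b \<bullet> k'"
    using assms(4) unfolding concatenates_def by blast
  have "e0 b \<bullet> w = e1 b \<bullet> u"
    using comp_square[OF S_square k(1) r0_in e0_in r1_in e1_in] assms(2) k by simp
  moreover have "u \<in> Hom a (P b)" "w \<in> Hom a (P b)"
    using k comp_in r0_in r1_in assms(2) by blast+
  ultimately have "k = k'" using S_pair[OF assms(1,2)] k k' by blast
  then show ?thesis using k k' by simp
qed

text \<open>
  Compatibility of the subdivision with \<open>c\<close> gives the case of the identity of \<open>b\<close>; the general case
  is its composite with \<open>y\<close>.
\<close>

lemma concatenates_const:
  assumes "a \<in> Ob" "b \<in> Ob" "y \<in> Hom a b" "concatenates a b (c b \<bullet> y) (c b \<bullet> y) q"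
  shows "q = c b \<bullet> y"
proof -
  have "concatenates b b (c b) (c b) (c b)"
    using S_const[OF assms(2)] unfolding concatenates_def by metis
  from concatenates_precomp[OF assms(2) this assms(3)] show ?thesis
    using concatenates_unique assms by blast
qed

lemma Pm_square:
  assumes "f \<bullet> g = f' \<bullet> g'" "X \<in> Hom a (P x)"
    and "g \<in> Hom x y" "f \<in> Hom y z" "g' \<in> Hom x y'" "f' \<in> Hom y' z"
    and "x \<in> Ob" "y \<in> Ob" "y' \<in> Ob" "z \<in> Ob"
  shows "Pm f \<bullet> (Pm g \<bullet> X) = Pm f' \<bullet> (Pm g' \<bullet> X)"
proof -
  have "Pm f \<bullet> Pm g = Pm f' \<bullet> Pm g'"
    using Pm_comp[OF assms(7,8,10,3,4)] Pm_comp[OF assms(7,9,10,5,6)] assms(1) by simp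
  from comp_square[OF this assms(2)] show ?thesis
    using Pm_in[OF assms(7,8,3)] Pm_in[OF assms(8,10,4)] Pm_in[OF assms(7,9,5)]
      Pm_in[OF assms(9,10,6)] by blast
qed

lemma natural_e0:
  assumes "x \<in> Ob" "y \<in> Ob" "f \<in> Hom x y" "X \<in> Hom a (P x)"
  shows "e0 y \<bullet> (Pm f \<bullet> X) = f \<bullet> (e0 x \<bullet> X)"
  using comp_square[OF e0_natural[OF assms(1,2,3)] assms(4) Pm_in[OF assms(1,2,3)]
    e0_in[OF assms(2)] e0_in[OF assms(1)] assms(3)] .

lemma natural_e1:
  assumes "x \<in> Ob" "y \<in> Ob" "f \<in> Hom x y" "X \<in> Hom a (P x)"
  shows "e1 y \<bullet> (Pm f \<bullet> X) = f \<bullet> (e1 x \<bullet> X)"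
  using comp_square[OF e1_natural[OF assms(1,2,3)] assms(4) Pm_in[OF assms(1,2,3)]
    e1_in[OF assms(2)] e1_in[OF assms(1)] assms(3)] .

text \<open>
  The square \<open>Y\<close> below, obtained from the connection, has top and left edge \<open>R\<close> and is constant on
  the two other edges. Reversing it horizontally gives a square \<open>X\<close> with top edge the reverse of
  \<open>R\<close> and right edge \<open>R\<close>. So \<open>X\<close> and \<open>Y\<close> fit together side by side, and all edges of the
  composite other than the top are constant.
\<close>

lemma null_homotopy:
  assumes a: "a \<in> Ob" and b: "b \<in> Ob" and R: "R \<in> Hom a (P b)" and y: "e1 b \<bullet> R = y"
    and q: "concatenates a b (v b \<bullet> R) R q"
  obtains W where "W \<in> Hom a (P (P b))" "e0 (P b) \<bullet> W = q" "e1 (P b) \<bullet> W = c b \<bullet> y"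
    "Pm (e0 b) \<bullet> W = c b \<bullet> y" "Pm (e1 b) \<bullet> W = c b \<bullet> y"
proof -
  note Ob = a b P_Ob[OF b] P_Ob[OF P_Ob[OF b]] S_Ob[OF b] P_Ob[OF S_Ob[OF b]]
  note ar = e0_in[OF b] e1_in[OF b] v_in[OF b] r0_in[OF b] r1_in[OF b] s_in[OF b] \<Gamma>_in[OF b] c_in[OF b]
    e0_in[OF P_Ob[OF b]] e1_in[OF P_Ob[OF b]]
  have yH: "y \<in> Hom a b" using y comp_in[OF R ar(2)] by simp
  define Y where "Y = \<Gamma> b \<bullet> R"
  have Y: "Y \<in> Hom a (P (P b))" unfolding Y_def using comp_in R ar by blast
  have Pe: "Pm (e0 b) \<in> Hom (P (P b)) (P b)" "Pm (e1 b) \<in> Hom (P (P b)) (P b)"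
      "Pm (v b) \<in> Hom (P (P b)) (P (P b))"
    using Pm_in ar Ob by blast+
  have Y0: "e0 (P b) \<bullet> Y = R" and Y0': "Pm (e0 b) \<bullet> Y = R"
    unfolding Y_def
    using comp_collapse[OF \<Gamma>_top[OF b] R ar(7) ar(9)] comp_collapse[OF \<Gamma>_left[OF b] R ar(7) Pe(1)]
      one_left[OF R] by simp_all
  have Y1: "e1 (P b) \<bullet> Y = c b \<bullet> y" and Y1': "Pm (e1 b) \<bullet> Y = c b \<bullet> y"
    unfolding Y_def y[symmetric]
    using comp_square[OF \<Gamma>_bottom[OF b] R ar(7,10,2,8)] comp_square[OF \<Gamma>_right[OF b] R ar(7) Pe(2) ar(2,8)] .
  define X where "X = Pm (v b) \<bullet> Y"
  have X: "X \<in> Hom a (P (P b))" unfolding X_def using comp_in[OF Y Pe(3)] .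
  have X0: "e0 (P b) \<bullet> X = v b \<bullet> R"
    unfolding X_def using natural_e0[OF Ob(3,3) ar(3) Y] Y0 by simp
  have X1: "e1 (P b) \<bullet> X = c b \<bullet> y"
    unfolding X_def using natural_e1[OF Ob(3,3) ar(3) Y] Y1 reverse_const[OF b yH] by simp
  have Pv: "Pm (e0 b) \<bullet> Pm (v b) = Pm (e1 b)" "Pm (e1 b) \<bullet> Pm (v b) = Pm (e0 b)"
    using Pm_comp[OF Ob(3,3,2) ar(3,1)] Pm_comp[OF Ob(3,3,2) ar(3,2)] e0_v[OF b] e1_v[OF b]
    by simp_all
  have X0': "Pm (e0 b) \<bullet> X = c b \<bullet> y"
    unfolding X_def using comp_collapse[OF Pv(1) Y Pe(3,1)] Y1' by simp
  have X1': "Pm (e1 b) \<bullet> X = R"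
    unfolding X_def using comp_collapse[OF Pv(2) Y Pe(3,2)] Y0' by simp
  \<comment> \<open>The pair of squares with common edge \<open>R\<close>; \<open>X\<close> is traversed first.\<close>
  obtain Z where Z: "Z \<in> Hom a (P (S b))" "Pm (r0 b) \<bullet> Z = Y" "Pm (r1 b) \<bullet> Z = X"
    using PS_pair[OF a b Y X] Y0' X1' by auto
  note nat0 = natural_e0[OF Ob(5,3) _ Z(1)] and nat1 = natural_e1[OF Ob(5,3) _ Z(1)]
  \<comment> \<open>By naturality, top and bottom of the glued square are concatenations of those of \<open>X\<close> and \<open>Y\<close>.\<close>
  have ends: "concatenates a b (e0 (P b) \<bullet> X) (e0 (P b) \<bullet> Y) (e0 (P b) \<bullet> (Pm (s b) \<bullet> Z))"
     "concatenates a b (e1 (P b) \<bullet> X) (e1 (P b) \<bullet> Y) (e1 (P b) \<bullet> (Pm (s b) \<bullet> Z))"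
    unfolding concatenates_def Z(2,3)[symmetric]
    using nat0[OF ar(4)] nat0[OF ar(5)] nat0[OF ar(6)] nat1[OF ar(4)] nat1[OF ar(5)] nat1[OF ar(6)]
      comp_in[OF Z(1) e0_in[OF Ob(5)]] comp_in[OF Z(1) e1_in[OF Ob(5)]] by auto
  show ?thesis
  proof
    show "Pm (s b) \<bullet> Z \<in> Hom a (P (P b))" using comp_in Z Pm_in ar Ob by blast
    show "e0 (P b) \<bullet> (Pm (s b) \<bullet> Z) = q"
      using concatenates_unique[OF a b _ q] ends(1) X0 Y0 by simp
    show "e1 (P b) \<bullet> (Pm (s b) \<bullet> Z) = c b \<bullet> y"
      using concatenates_const[OF a b yH] ends(2) X1 Y1 by simp
    show "Pm (e0 b) \<bullet> (Pm (s b) \<bullet> Z) = c b \<bullet> y"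
      using Pm_square[OF e0_s[OF b] Z(1) ar(6,1,5,1)] Ob Z X0' by simp
    show "Pm (e1 b) \<bullet> (Pm (s b) \<bullet> Z) = c b \<bullet> y"
      using Pm_square[OF e1_s[OF b] Z(1) ar(6,2,4,2)] Ob Z Y1' by simp
  qed
qed

text \<open>
  The homotopy extension property in terms of paths: \<open>j\<close> has the left lifting property with respect
  to every \<open>e0 b\<close>.
\<close>

definition lifts_paths :: "'m \<Rightarrow> 'm \<Rightarrow> 'c \<Rightarrow> bool" where
  "lifts_paths a0 a1 j \<longleftrightarrow> j \<in> Hom a0 a1 \<and>
     (\<forall>b \<in> Ob. \<forall>f \<in> Hom a1 b. \<forall>H \<in> Hom a0 (P b). e0 b \<bullet> H = f \<bullet> j \<longrightarrow>
        (\<exists>K \<in> Hom a1 (P b). K \<bullet> j = H \<and> e0 b \<bullet> K = f))"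

text \<open>
  If a path from \<open>g \<bullet> j\<close> to the identity is lifted along \<open>j\<close> with starting point \<open>g\<close>, the end point
  of the lift is a retraction \<open>f\<close>. Applying \<open>j\<close> to the lift connects \<open>j \<bullet> g\<close> to \<open>j \<bullet> f\<close>, so \<open>j \<bullet> f\<close>
  is still deformable to the identity.
\<close>

lemma strict_retraction:
  assumes a0: "a0 \<in> Ob" and a1: "a1 \<in> Ob" and j: "lifts_paths a0 a1 j"
    and g: "g \<in> Hom a1 a0"
    and H: "H \<in> Hom a0 (P a0)" "e0 a0 \<bullet> H = g \<bullet> j" "e1 a0 \<bullet> H = one a0"
    and G: "G \<in> Hom a1 (P a1)" "e0 a1 \<bullet> G = j \<bullet> g" "e1 a1 \<bullet> G = one a1"
  obtains f D where "f \<in> Hom a1 a0" "f \<bullet> j = one a0"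
    "D \<in> Hom a1 (P a1)" "e0 a1 \<bullet> D = j \<bullet> f" "e1 a1 \<bullet> D = one a1"
proof -
  have jH: "j \<in> Hom a0 a1" using j unfolding lifts_paths_def by blast
  obtain K where K: "K \<in> Hom a1 (P a0)" "K \<bullet> j = H" "e0 a0 \<bullet> K = g"
    using j a0 g H unfolding lifts_paths_def by blast
  define f where "f = e1 a0 \<bullet> K"
  have f: "f \<in> Hom a1 a0" unfolding f_def using comp_in K e1_in a0 by blast
  have fj: "f \<bullet> j = one a0"
    unfolding f_def using comp_assoc[OF jH K(1) e1_in[OF a0]] K H by simp
  define N where "N = Pm j \<bullet> K"
  have N: "N \<in> Hom a1 (P a1)" unfolding N_def using comp_in K(1) Pm_in[OF a0 a1 jH] by blast
  have N0: "e0 a1 \<bullet> N = j \<bullet> g" and N1: "e1 a1 \<bullet> N = j \<bullet> f"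
    unfolding N_def f_def using natural_e0[OF a0 a1 jH K(1)] natural_e1[OF a0 a1 jH K(1)] K by simp_all
  have "e1 a1 \<bullet> (v a1 \<bullet> N) = e0 a1 \<bullet> G" using path_reverse[OF a1 N] N0 G by simp
  then obtain D where D: "concatenates a1 a1 (v a1 \<bullet> N) G D"
    using concatenates_exists[OF a1 a1 _ G(1)] path_reverse[OF a1 N] by blast
  show ?thesis
    using that[OF f fj] concatenates_path[OF a1 D] path_reverse[OF a1 N] N1 G by simp
qed

text \<open>
  The core of the argument. The deformation \<open>D\<close> is first replaced by one whose restriction along \<open>j\<close>
  is contractible relative to its end points, and this contraction is then extended along \<open>j\<close>.
\<close>

lemma rectify_deformation:
  assumes a0: "a0 \<in> Ob" and a1: "a1 \<in> Ob" and j: "lifts_paths a0 a1 j"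
    and f: "f \<in> Hom a1 a0" "f \<bullet> j = one a0"
    and D: "D \<in> Hom a1 (P a1)" "e0 a1 \<bullet> D = j \<bullet> f" "e1 a1 \<bullet> D = one a1"
  obtains D' where "D' \<in> Hom a1 (P a1)" "e0 a1 \<bullet> D' = j \<bullet> f" "e1 a1 \<bullet> D' = one a1"
    "D' \<bullet> j = c a1 \<bullet> j"
proof -
  have jH: "j \<in> Hom a0 a1" using j unfolding lifts_paths_def by blast
  note e = e0_in[OF a1] e1_in[OF a1] e0_in[OF P_Ob[OF a1]] e1_in[OF P_Ob[OF a1]] v_in[OF a1]
  have Pe: "Pm (e0 a1) \<in> Hom (P (P a1)) (P a1)" "Pm (e1 a1) \<in> Hom (P (P a1)) (P a1)"
    using Pm_in P_Ob a1 e by blast+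
  have jf: "j \<bullet> f \<in> Hom a1 a1" using comp_in jH f by blast
  have jfj: "(j \<bullet> f) \<bullet> j = j" using comp_assoc[OF jH f(1) jH] f one_right[OF jH] by simp
  have jfjf: "(j \<bullet> f) \<bullet> (j \<bullet> f) = j \<bullet> f" using comp_assoc[OF f(1) jH jf] jfj by simp
  define E where "E = D \<bullet> (j \<bullet> f)"
  have E: "E \<in> Hom a1 (P a1)" unfolding E_def using comp_in jf D by blast
  have E0: "e0 a1 \<bullet> E = j \<bullet> f" and E1: "e1 a1 \<bullet> E = j \<bullet> f"
    unfolding E_def
    using comp_collapse[OF D(2) jf D(1) e(1)] comp_collapse[OF D(3) jf D(1) e(2)] jfjf one_left[OF jf]
    by simp_all
  have Ej: "E \<bullet> j = D \<bullet> j"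
    unfolding E_def using comp_assoc[OF jH jf D(1)] jfj by simp
  \<comment> \<open>The edge \<open>Q\<close> runs backwards along \<open>E\<close>, then along \<open>D\<close>; since \<open>E\<close> and \<open>D\<close> agree on \<open>j\<close>, it cancels there.\<close>
  obtain Q where Q: "concatenates a1 a1 (v a1 \<bullet> E) D Q"
    using concatenates_exists[OF a1 a1 _ D(1)] path_reverse[OF a1 E] E0 D by auto
  note QH = concatenates_path[OF a1 Q]
  have Dj: "D \<bullet> j \<in> Hom a0 (P a1)" "e1 a1 \<bullet> (D \<bullet> j) = j"
    using comp_in jH D comp_collapse[OF D(3) jH D(1) e(2)] one_left[OF jH] by auto
  have "concatenates a0 a1 (v a1 \<bullet> (D \<bullet> j)) (D \<bullet> j) (Q \<bullet> j)"
    using concatenates_precomp[OF a1 Q jH] comp_assoc[OF jH E e(5)] Ej by simp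
  then obtain W where W: "W \<in> Hom a0 (P (P a1))" "e0 (P a1) \<bullet> W = Q \<bullet> j"
      "e1 (P a1) \<bullet> W = c a1 \<bullet> j" "Pm (e0 a1) \<bullet> W = c a1 \<bullet> j" "Pm (e1 a1) \<bullet> W = c a1 \<bullet> j"
    using null_homotopy[OF a0 a1 Dj] by blast
  obtain K where K: "K \<in> Hom a1 (P (P a1))" "K \<bullet> j = W" "e0 (P a1) \<bullet> K = Q"
    using j P_Ob[OF a1] QH(1) W(1,2) unfolding lifts_paths_def by blast
  \<comment> \<open>The path sought goes down the left edge \<open>L\<close>, along the bottom \<open>B\<close>, and up the right edge \<open>N\<close>.\<close>
  define L where "L = Pm (e0 a1) \<bullet> K"
  define B where "B = e1 (P a1) \<bullet> K"
  define N where "N = Pm (e1 a1) \<bullet> K"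
  have LBN: "L \<in> Hom a1 (P a1)" "B \<in> Hom a1 (P a1)" "N \<in> Hom a1 (P a1)"
    unfolding L_def B_def N_def using comp_in[OF K(1)] e Pe by blast+
  have on_j: "L \<bullet> j = c a1 \<bullet> j" "B \<bullet> j = c a1 \<bullet> j" "N \<bullet> j = c a1 \<bullet> j"
    unfolding L_def B_def N_def
    using comp_assoc[OF jH K(1) Pe(1)] comp_assoc[OF jH K(1) e(4)] comp_assoc[OF jH K(1) Pe(2)]
      K(2) W by simp_all
  note nat0 = natural_e0[OF P_Ob[OF a1] a1 _ K(1)] and nat1 = natural_e1[OF P_Ob[OF a1] a1 _ K(1)]
  have L0: "e0 a1 \<bullet> L = j \<bullet> f"
    unfolding L_def using nat0[OF e(1)] K(3) QH path_reverse[OF a1 E] E1 by simp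
  have LB: "e1 a1 \<bullet> L = e0 a1 \<bullet> B"
    unfolding L_def B_def using nat1[OF e(1)] by simp
  have BN: "e1 a1 \<bullet> B = e1 a1 \<bullet> N"
    unfolding N_def B_def using nat1[OF e(2)] by simp
  have N0: "e0 a1 \<bullet> N = one a1"
    unfolding N_def using nat0[OF e(2)] K(3) QH D by simp
  obtain q where q: "concatenates a1 a1 L B q"
    using concatenates_exists[OF a1 a1 LBN(1,2) LB] by blast
  note qH = concatenates_path[OF a1 q] and Nv = path_reverse[OF a1 LBN(3)]
  obtain D' where D': "concatenates a1 a1 q (v a1 \<bullet> N) D'"
    using concatenates_exists[OF a1 a1 qH(1) Nv(1)] qH Nv BN by auto
  note D'H = concatenates_path[OF a1 D']
  have qj: "q \<bullet> j = c a1 \<bullet> j"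
    using concatenates_precomp[OF a1 q jH] on_j concatenates_const[OF a0 a1 jH] by simp
  have "(v a1 \<bullet> N) \<bullet> j = c a1 \<bullet> j"
    using comp_assoc[OF jH LBN(3) e(5)] on_j reverse_const[OF a1 jH] by simp
  then have "D' \<bullet> j = c a1 \<bullet> j"
    using concatenates_precomp[OF a1 D' jH] qj concatenates_const[OF a0 a1 jH] by simp
  with D'H show ?thesis using that L0 qH Nv N0 by simp
qed

end

section \<open>Evaluating 2-arrows at objects\<close>

context strict_2_category
begin

lemma whisker_in:
  assumes "F \<in> hom1 C Y Z" "a \<in> hom1 C X Y" "b \<in> hom1 C X Y" "f \<in> hom2 C a b"
  shows "F \<rhd> f \<in> hom2 C (F \<odot> a) (F \<odot> b)"
  unfolding whisker_left_def
  using hcomp_hom[OF assms(2,3,1,1,4)] id2_hom assms(1) unfolding hom1_def by blast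

lemma evaluation_in:
  assumes "F \<in> hom1 C Y Z" "G \<in> hom1 C Y Z" "\<alpha> \<in> hom2 C F G" "a \<in> hom1 C X Y"
  shows "\<alpha> \<lhd> a \<in> hom2 C (F \<odot> a) (G \<odot> a)"
  unfolding whisker_right_def
  using hcomp_hom[OF assms(4,4,1,2) _ assms(3)] id2_hom assms(4) unfolding hom1_def by blast

lemma id2_in: "F \<in> hom1 C X Y \<Longrightarrow> id2 C F \<in> hom2 C F F"
  using id2_hom unfolding hom1_def by blast

lemma whisker_comp:
  assumes "F \<in> hom1 C Y Z" "a \<in> hom1 C X Y" "f \<in> hom2 C a b" "g \<in> hom2 C b d"
  shows "F \<rhd> (g \<cdot> f) = (F \<rhd> g) \<cdot> (F \<rhd> f)"
  unfolding whisker_left_def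
  using interchange[OF assms(2,1,3,4) id2_in id2_in] assms(1) vcomp_id_left[OF id2_in] by simp

lemma evaluation_comp:
  assumes "F \<in> hom1 C Y Z" "\<alpha> \<in> hom2 C F G" "\<beta> \<in> hom2 C G H" "a \<in> hom1 C X Y"
  shows "(\<beta> \<cdot> \<alpha>) \<lhd> a = (\<beta> \<lhd> a) \<cdot> (\<alpha> \<lhd> a)"
  unfolding whisker_right_def
  using interchange[OF assms(4,1) id2_in id2_in assms(2,3)] assms(4) vcomp_id_left[OF id2_in] by simp

lemma evaluation_natural:
  assumes "F \<in> hom1 C Y Z" "\<alpha> \<in> hom2 C F G" "a \<in> hom1 C X Y" "b \<in> hom1 C X Y" "f \<in> hom2 C a b"
    "G \<in> hom1 C Y Z"
  shows "(\<alpha> \<lhd> b) \<cdot> (F \<rhd> f) = (G \<rhd> f) \<cdot> (\<alpha> \<lhd> a)"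
  unfolding whisker_right_def whisker_left_def
  using interchange[OF assms(3,1,5) id2_in id2_in assms(2)] 
    interchange[OF assms(3,1) id2_in assms(5,2) id2_in] assms
    vcomp_id_left vcomp_id_right by simp

lemma evaluation_id2:
  assumes "F \<in> hom1 C Y Z" "a \<in> hom1 C X Y"
  shows "id2 C F \<lhd> a = id2 C (F \<odot> a)"
  unfolding whisker_right_def using hcomp_id2 assms by blast

lemma evaluation_whisker:
  assumes "F \<in> hom1 C X Y" "G \<in> hom1 C Y Z" "\<alpha> \<in> hom2 C F F'" "a \<in> hom1 C W X"
  shows "(G \<rhd> \<alpha>) \<lhd> a = G \<rhd> (\<alpha> \<lhd> a)"
  unfolding whisker_right_def whisker_left_def
  using hcomp_assoc[OF assms(4,1,2) id2_in assms(3) id2_in] assms by blast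

lemma evaluation_evaluation:
  assumes "F \<in> hom1 C X Y" "G \<in> hom1 C Y Z" "\<alpha> \<in> hom2 C G G'" "a \<in> hom1 C W X"
  shows "(\<alpha> \<lhd> F) \<lhd> a = \<alpha> \<lhd> (F \<odot> a)"
  unfolding whisker_right_def
  using hcomp_assoc[OF assms(4,1,2) id2_in id2_in assms(3)] assms hcomp_id2[OF assms(4,1)] by simp

lemma pullback_square_pair:
  assumes "pullback_square C X Y q0 q1 f g"
    and "q0 \<in> hom2 C P F" "q1 \<in> hom2 C P G" "f \<in> hom2 C F H" "g \<in> hom2 C G H"
    and "a \<in> hom1 C X Y" "u \<in> hom2 C a F" "w \<in> hom2 C a G" "f \<cdot> u = g \<cdot> w"
  shows "\<exists>!k. k \<in> hom2 C a P \<and> q0 \<cdot> k = u \<and> q1 \<cdot> k = w"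
proof -
  obtain P' F' G' where h: "q0 \<in> hom2 C P' F'" "q1 \<in> hom2 C P' G'"
    and univ: "\<forall>T \<in> hom1 C X Y. \<forall>u \<in> hom2 C T F'. \<forall>w \<in> hom2 C T G'. f \<cdot> u = g \<cdot> w \<longrightarrow>
       (\<exists>!k. k \<in> hom2 C T P' \<and> q0 \<cdot> k = u \<and> q1 \<cdot> k = w)"
    using assms(1) unfolding pullback_square_def by blast
  have "P' = P" "F' = F" "G' = G" using h assms(2,3) unfolding hom2_def by auto
  then show ?thesis using univ assms(6-9) by simp
qed

lemma whisker_id1:
  assumes "a \<in> hom1 C X Y" "f \<in> hom2 C a b"
  shows "id1 C Y \<rhd> f = f"
  unfolding whisker_left_def using hcomp_id_left assms by blast

end

section \<open>The adjunction on arrows\<close>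

text \<open>
  Both directions of the hom-set bijection are needed with their naturality, but an adjunction in a
  2-category only provides a unit and a counit. They are evaluated at objects, and the usual
  computation with the triangle identities is carried out there.
\<close>

locale cylinder_adjunction = formal_category C T A
  for C :: "('o, 'm, 'c, 'z) two_category_scheme" (structure) and T A :: 'o +
  fixes L R :: 'm and \<eta> \<epsilon> :: 'c
  assumes adjunction: "adjunction C A A L R \<eta> \<epsilon>"
begin

text \<open>The inverse of \<open>adj\<close>.\<close>

definition transpose :: "'m \<Rightarrow> 'c \<Rightarrow> 'c" where
  "transpose b X = (\<epsilon> \<lhd> b) \<cdot> (L \<rhd> X)"

lemma L_in: "L \<in> hom1 C A A" and R_in: "R \<in> hom1 C A A"
  and unit_in: "\<eta> \<in> hom2 C (id1 C A) (R \<odot> L)" and counit_in: "\<epsilon> \<in> hom2 C (L \<odot> R) (id1 C A)"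
  and triangle_L: "(\<epsilon> \<lhd> L) \<cdot> (L \<rhd> \<eta>) = id2 C L"
  and triangle_R: "(R \<rhd> \<epsilon>) \<cdot> (\<eta> \<lhd> R) = id2 C R"
  using adjunction unfolding adjunction_def by blast+

lemma I_in: "id1 C A \<in> hom1 C A A" using id1_hom A_obj by blast

lemma LR_in: "L \<odot> R \<in> hom1 C A A" and RL_in: "R \<odot> L \<in> hom1 C A A"
  using comp1_hom L_in R_in by blast+

lemma value_in: "\<lbrakk>F \<in> hom1 C A A; a \<in> hom1 C T A\<rbrakk> \<Longrightarrow> F \<odot> a \<in> hom1 C T A"
  using comp1_hom by blast

lemma unit_at: "a \<in> hom1 C T A \<Longrightarrow> \<eta> \<lhd> a \<in> hom2 C a (R \<odot> (L \<odot> a))"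
  using evaluation_in[OF I_in RL_in unit_in] comp1_id_left comp1_assoc[OF _ L_in R_in] by metis

lemma counit_at: "a \<in> hom1 C T A \<Longrightarrow> \<epsilon> \<lhd> a \<in> hom2 C (L \<odot> (R \<odot> a)) a"
  using evaluation_in[OF LR_in I_in counit_in] comp1_id_left comp1_assoc[OF _ R_in L_in] by metis

lemma composite_whisker:
  assumes "F \<in> hom1 C A A" "G \<in> hom1 C A A" "a \<in> hom1 C T A" "f \<in> hom2 C a b"
  shows "(G \<odot> F) \<rhd> f = G \<rhd> (F \<rhd> f)"
  unfolding whisker_left_def
  using hcomp_assoc[OF assms(3,1,2,4) id2_in id2_in] assms hcomp_id2[OF assms(1,2)] by simp

lemma unit_natural:
  assumes "a \<in> hom1 C T A" "b \<in> hom1 C T A" "f \<in> hom2 C a b"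
  shows "(\<eta> \<lhd> b) \<cdot> f = (R \<rhd> (L \<rhd> f)) \<cdot> (\<eta> \<lhd> a)"
  using evaluation_natural[OF I_in unit_in assms RL_in] whisker_id1[OF assms(1,3)]
    composite_whisker[OF L_in R_in assms(1,3)] by simp

lemma counit_natural:
  assumes "a \<in> hom1 C T A" "b \<in> hom1 C T A" "f \<in> hom2 C a b"
  shows "(\<epsilon> \<lhd> b) \<cdot> (L \<rhd> (R \<rhd> f)) = f \<cdot> (\<epsilon> \<lhd> a)"
  using evaluation_natural[OF LR_in counit_in assms I_in] whisker_id1[OF assms(1,3)]
    composite_whisker[OF R_in L_in assms(1,3)] by simp

lemma triangle_L_at:
  assumes "a \<in> hom1 C T A"
  shows "(\<epsilon> \<lhd> (L \<odot> a)) \<cdot> (L \<rhd> (\<eta> \<lhd> a)) = id2 C (L \<odot> a)"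
proof -
  have 1: "L \<rhd> \<eta> \<in> hom2 C L (L \<odot> (R \<odot> L))"
    using whisker_in[OF L_in I_in RL_in unit_in] comp1_id_right[OF L_in] by simp
  have 2: "\<epsilon> \<lhd> L \<in> hom2 C (L \<odot> (R \<odot> L)) L"
    using evaluation_in[OF LR_in I_in counit_in L_in] comp1_id_left[OF L_in]
      comp1_assoc[OF L_in R_in L_in] by simp
  show ?thesis
    using evaluation_comp[OF L_in 1 2 assms] evaluation_whisker[OF I_in L_in unit_in assms]
      evaluation_evaluation[OF L_in LR_in counit_in assms] triangle_L evaluation_id2[OF L_in assms]
    by simp
qed

lemma triangle_R_at:
  assumes "a \<in> hom1 C T A"
  shows "(R \<rhd> (\<epsilon> \<lhd> a)) \<cdot> (\<eta> \<lhd> (R \<odot> a)) = id2 C (R \<odot> a)"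
proof -
  have 1: "R \<rhd> \<epsilon> \<in> hom2 C (R \<odot> (L \<odot> R)) R"
    using whisker_in[OF R_in LR_in I_in counit_in] comp1_id_right[OF R_in] by simp
  have 2: "\<eta> \<lhd> R \<in> hom2 C R (R \<odot> (L \<odot> R))"
    using evaluation_in[OF I_in RL_in unit_in R_in] comp1_id_left[OF R_in]
      comp1_assoc[OF R_in L_in R_in] by simp
  show ?thesis
    using evaluation_comp[OF R_in 2 1 assms] evaluation_whisker[OF LR_in R_in counit_in assms]
      evaluation_evaluation[OF R_in I_in unit_in assms] triangle_R evaluation_id2[OF R_in assms]
    by simp
qed

lemma adj_in:
  assumes a: "a \<in> hom1 C T A" and b: "b \<in> hom1 C T A" and h: "h \<in> hom2 C (L \<odot> a) b"
  shows "adj C R \<eta> a h \<in> hom2 C a (R \<odot> b)"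
  unfolding adj_def
  using vcomp_hom[OF unit_at[OF a] whisker_in[OF R_in value_in[OF L_in a] b h]] .

lemma transpose_in:
  assumes a: "a \<in> hom1 C T A" and b: "b \<in> hom1 C T A" and X: "X \<in> hom2 C a (R \<odot> b)"
  shows "transpose b X \<in> hom2 C (L \<odot> a) b"
  unfolding transpose_def
  using vcomp_hom[OF whisker_in[OF L_in a value_in[OF R_in b] X] counit_at[OF b]] .

lemma adj_transpose:
  assumes a: "a \<in> hom1 C T A" and b: "b \<in> hom1 C T A" and X: "X \<in> hom2 C a (R \<odot> b)"
  shows "adj C R \<eta> a (transpose b X) = X"
proof -
  note Rb = value_in[OF R_in b]
  note LX = whisker_in[OF L_in a Rb X]
  have "adj C R \<eta> a (transpose b X) = ((R \<rhd> (\<epsilon> \<lhd> b)) \<cdot> (R \<rhd> (L \<rhd> X))) \<cdot> (\<eta> \<lhd> a)"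
    unfolding adj_def transpose_def
    using whisker_comp[OF R_in value_in[OF L_in a] LX counit_at[OF b]] by simp
  also have "\<dots> = (R \<rhd> (\<epsilon> \<lhd> b)) \<cdot> ((R \<rhd> (L \<rhd> X)) \<cdot> (\<eta> \<lhd> a))"
    using vcomp_assoc[OF unit_at[OF a] whisker_in[OF R_in value_in[OF L_in a] value_in[OF L_in Rb] LX]
      whisker_in[OF R_in value_in[OF L_in Rb] b counit_at[OF b]]] .
  also have "\<dots> = (R \<rhd> (\<epsilon> \<lhd> b)) \<cdot> ((\<eta> \<lhd> (R \<odot> b)) \<cdot> X)"
    using unit_natural[OF a Rb X] by simp
  also have "\<dots> = id2 C (R \<odot> b) \<cdot> X"
    using vcomp_assoc[OF X unit_at[OF Rb] whisker_in[OF R_in value_in[OF L_in Rb] b counit_at[OF b]]]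
      triangle_R_at[OF b] by simp
  finally show ?thesis using vcomp_id_left[OF X] by simp
qed

lemma transpose_adj:
  assumes a: "a \<in> hom1 C T A" and b: "b \<in> hom1 C T A" and h: "h \<in> hom2 C (L \<odot> a) b"
  shows "transpose b (adj C R \<eta> a h) = h"
proof -
  note La = value_in[OF L_in a]
  note RLa = value_in[OF R_in La] and Rb = value_in[OF R_in b]
  note Rh = whisker_in[OF R_in La b h]
  have "transpose b (adj C R \<eta> a h) = (\<epsilon> \<lhd> b) \<cdot> ((L \<rhd> (R \<rhd> h)) \<cdot> (L \<rhd> (\<eta> \<lhd> a)))"
    unfolding adj_def transpose_def using whisker_comp[OF L_in a unit_at[OF a] Rh] by simp
  also have "\<dots> = ((\<epsilon> \<lhd> b) \<cdot> (L \<rhd> (R \<rhd> h))) \<cdot> (L \<rhd> (\<eta> \<lhd> a))"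
    using vcomp_assoc[OF whisker_in[OF L_in a RLa unit_at[OF a]] whisker_in[OF L_in RLa Rb Rh]
      counit_at[OF b]] by simp
  also have "\<dots> = (h \<cdot> (\<epsilon> \<lhd> (L \<odot> a))) \<cdot> (L \<rhd> (\<eta> \<lhd> a))"
    using counit_natural[OF La b h] by simp
  also have "\<dots> = h \<cdot> id2 C (L \<odot> a)"
    using vcomp_assoc[OF whisker_in[OF L_in a RLa unit_at[OF a]] counit_at[OF La] h]
      triangle_L_at[OF a] by simp
  finally show ?thesis using vcomp_id_right[OF h] by simp
qed

lemma transpose_precomp:
  assumes a: "a \<in> hom1 C T A" "a' \<in> hom1 C T A" and b: "b \<in> hom1 C T A"
    and x: "x \<in> hom2 C a' a" and X: "X \<in> hom2 C a (R \<odot> b)"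
  shows "transpose b (X \<cdot> x) = transpose b X \<cdot> (L \<rhd> x)"
  unfolding transpose_def
  using whisker_comp[OF L_in a(2) x X] vcomp_assoc[OF whisker_in[OF L_in a(2,1) x]
    whisker_in[OF L_in a(1) value_in[OF R_in b] X] counit_at[OF b]] by simp

lemma transpose_postcomp:
  assumes a: "a \<in> hom1 C T A" and b: "b \<in> hom1 C T A" "b' \<in> hom1 C T A"
    and f: "f \<in> hom2 C b b'" and X: "X \<in> hom2 C a (R \<odot> b)"
  shows "transpose b' ((R \<rhd> f) \<cdot> X) = f \<cdot> transpose b X"
proof -
  note Rb = value_in[OF R_in b(1)] and Rb' = value_in[OF R_in b(2)]
  note Rf = whisker_in[OF R_in b f] and LX = whisker_in[OF L_in a Rb X]
  have "transpose b' ((R \<rhd> f) \<cdot> X) = ((\<epsilon> \<lhd> b') \<cdot> (L \<rhd> (R \<rhd> f))) \<cdot> (L \<rhd> X)"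
    unfolding transpose_def
    using whisker_comp[OF L_in a X Rf]
      vcomp_assoc[OF LX whisker_in[OF L_in Rb Rb' Rf] counit_at[OF b(2)]] by simp
  then show ?thesis
    unfolding transpose_def
    using counit_natural[OF b f] vcomp_assoc[OF LX counit_at[OF b(1)] f] by simp
qed

lemma adj_postcomp:
  assumes a: "a \<in> hom1 C T A" and b: "b \<in> hom1 C T A" "b' \<in> hom1 C T A"
    and f: "f \<in> hom2 C b b'" and h: "h \<in> hom2 C (L \<odot> a) b"
  shows "adj C R \<eta> a (f \<cdot> h) = (R \<rhd> f) \<cdot> adj C R \<eta> a h"
  unfolding adj_def
  using whisker_comp[OF R_in value_in[OF L_in a] h f] vcomp_assoc[OF unit_at[OF a]
    whisker_in[OF R_in value_in[OF L_in a] b(1) h] whisker_in[OF R_in b f]] by simp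

text \<open>
  Naturality in the first argument follows from that of the inverse bijection, where it is just
  functoriality of \<open>L\<close>.
\<close>

lemma adj_precomp:
  assumes a: "a \<in> hom1 C T A" "a' \<in> hom1 C T A" and b: "b \<in> hom1 C T A"
    and x: "x \<in> hom2 C a' a" and h: "h \<in> hom2 C (L \<odot> a) b"
  shows "adj C R \<eta> a' (h \<cdot> (L \<rhd> x)) = adj C R \<eta> a h \<cdot> x"
proof -
  note La = value_in[OF L_in a(1)] and La' = value_in[OF L_in a(2)]
  have "transpose b (adj C R \<eta> a h \<cdot> x) = h \<cdot> (L \<rhd> x)"
    using transpose_precomp[OF a b x adj_in[OF a(1) b h]] transpose_adj[OF a(1) b h] by simp
  then show ?thesis
    using adj_transpose[OF a(2) b vcomp_hom[OF x adj_in[OF a(1) b h]]] by simp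
qed

text \<open>
  A right adjoint preserves pullbacks: a compatible pair of arrows into \<open>R \<odot> F\<close> and \<open>R \<odot> G\<close> is
  transposed, paired by the pullback property, and transposed back.
\<close>

lemma right_adjoint_pair:
  assumes pb: "pullback_square C T A q0 q1 f g"
    and F: "P \<in> hom1 C T A" "F \<in> hom1 C T A" "G \<in> hom1 C T A" "H \<in> hom1 C T A"
    and ar: "q0 \<in> hom2 C P F" "q1 \<in> hom2 C P G" "f \<in> hom2 C F H" "g \<in> hom2 C G H"
    and a: "a \<in> hom1 C T A"
    and u: "u \<in> hom2 C a (R \<odot> F)" and w: "w \<in> hom2 C a (R \<odot> G)"
    and eq: "(R \<rhd> f) \<cdot> u = (R \<rhd> g) \<cdot> w"
  shows "\<exists>k \<in> hom2 C a (R \<odot> P). (R \<rhd> q0) \<cdot> k = u \<and> (R \<rhd> q1) \<cdot> k = w"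
proof -
  have "f \<cdot> transpose F u = g \<cdot> transpose G w"
    using transpose_postcomp[OF a F(2,4) ar(3) u] transpose_postcomp[OF a F(3,4) ar(4) w] eq by simp
  then obtain k where k: "k \<in> hom2 C (L \<odot> a) P" "q0 \<cdot> k = transpose F u" "q1 \<cdot> k = transpose G w"
    using pullback_square_pair[OF pb ar value_in[OF L_in a] transpose_in[OF a F(2) u]
      transpose_in[OF a F(3) w]] by blast
  show ?thesis
  proof (intro bexI conjI)
    show "(R \<rhd> q0) \<cdot> adj C R \<eta> a k = u"
      using adj_postcomp[OF a F(1,2) ar(1) k(1)] adj_transpose[OF a F(2) u] k(2) by simp
    show "(R \<rhd> q1) \<cdot> adj C R \<eta> a k = w"
      using adj_postcomp[OF a F(1,3) ar(2) k(1)] adj_transpose[OF a F(3) w] k(3) by simp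
    show "adj C R \<eta> a k \<in> hom2 C a (R \<odot> P)" using adj_in[OF a F(1) k(1)] .
  qed
qed

lemma evaluated_equation:
  assumes "F \<in> hom1 C A A" "\<alpha> \<in> hom2 C F G" "\<beta> \<in> hom2 C G H" "\<beta> \<cdot> \<alpha> = \<gamma>" "a \<in> hom1 C T A"
  shows "(\<beta> \<lhd> a) \<cdot> (\<alpha> \<lhd> a) = \<gamma> \<lhd> a"
  using evaluation_comp[OF assms(1,2,3,5)] assms(4) by simp

text \<open>
  Every equation between 2-arrows may be evaluated at an object. The pullback property of \<open>S\<close>
  survives by the standing assumption on evaluation. It is also used before evaluation, to know
  that \<open>contraction_lift\<close> denotes an arrow.
\<close>

lemma evaluated_cocylinder:
  assumes cocyl: "cocylinder C A R e0 e1"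
    and contr: "cocyl_contraction C A R e0 e1 c"
    and invol: "cocyl_involution C R e0 e1 v"
    and v_c: "involution_compatible C v c"
    and subdiv: "cocyl_subdivision C A R e0 e1 S r0 r1 s"
    and s_c: "subdivision_compatible C A S r0 r1 s c"
    and conn: "upper_left_connection C R e0 e1 c \<Gamma>"
  shows "path_category (hom1 C T A) (hom2 C) (vcomp C) (id2 C) (comp1 C R) (whisker_left C R)
    (whisker_right C e0) (whisker_right C e1) (whisker_right C c) (whisker_right C v)
    (comp1 C S) (whisker_right C r0) (whisker_right C r1) (whisker_right C s) (whisker_right C \<Gamma>)"
proof -
  have e: "e0 \<in> hom2 C R (id1 C A)" "e1 \<in> hom2 C R (id1 C A)"
    using cocyl unfolding cocylinder_def by blast+
  have c: "c \<in> hom2 C (id1 C A) R" "e0 \<cdot> c = id2 C (id1 C A)" "e1 \<cdot> c = id2 C (id1 C A)"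
    using contr unfolding cocyl_contraction_def by blast+
  have v: "v \<in> hom2 C R R" "e0 \<cdot> v = e1" "e1 \<cdot> v = e0" "v \<cdot> c = c"
    using invol v_c unfolding cocyl_involution_def involution_compatible_def by blast+
  have S: "S \<in> hom1 C A A" and r: "r0 \<in> hom2 C S R" "r1 \<in> hom2 C S R"
    and pb: "pullback_square C A A r0 r1 e0 e1"
    and s: "s \<in> hom2 C S R" "e0 \<cdot> s = e0 \<cdot> r1" "e1 \<cdot> s = e1 \<cdot> r0"
    using subdiv unfolding cocyl_subdivision_def by blast+
  have \<Gamma>: "\<Gamma> \<in> hom2 C R (R \<odot> R)" "(e0 \<lhd> R) \<cdot> \<Gamma> = id2 C R" "(R \<rhd> e0) \<cdot> \<Gamma> = id2 C R"
    "(e1 \<lhd> R) \<cdot> \<Gamma> = c \<cdot> e1" "(R \<rhd> e1) \<cdot> \<Gamma> = c \<cdot> e1"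
    using conn unfolding upper_left_connection_def by blast+
  have RR: "R \<odot> R \<in> hom1 C A A" using comp1_hom R_in by blast
  have e_at: "e0 \<lhd> b \<in> hom2 C (R \<odot> b) b" "e1 \<lhd> b \<in> hom2 C (R \<odot> b) b" if "b \<in> hom1 C T A" for b
    using evaluation_in[OF R_in I_in _ that] e comp1_id_left[OF that] by force+
  have c_at: "c \<lhd> b \<in> hom2 C b (R \<odot> b)" if "b \<in> hom1 C T A" for b
    using evaluation_in[OF I_in R_in c(1) that] comp1_id_left[OF that] by simp
  have r_at: "r0 \<lhd> b \<in> hom2 C (S \<odot> b) (R \<odot> b)" "r1 \<lhd> b \<in> hom2 C (S \<odot> b) (R \<odot> b)"
    if "b \<in> hom1 C T A" for b
    using evaluation_in[OF S R_in _ that] r by blast+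
  have pb_at: "pullback_square C T A (r0 \<lhd> b) (r1 \<lhd> b) (e0 \<lhd> b) (e1 \<lhd> b)"
    if "b \<in> hom1 C T A" for b
    using evaluation_pullback[OF A_obj A_obj that pb] .
  have eR: "e0 \<lhd> R \<in> hom2 C (R \<odot> R) R" "e1 \<lhd> R \<in> hom2 C (R \<odot> R) R"
    using evaluation_in[OF R_in I_in _ R_in] e comp1_id_left[OF R_in] by force+
  have Re: "R \<rhd> e0 \<in> hom2 C (R \<odot> R) R" "R \<rhd> e1 \<in> hom2 C (R \<odot> R) R"
    using whisker_in[OF R_in R_in I_in] e comp1_id_right[OF R_in] by force+
  have square: "e0 \<cdot> r0 = e1 \<cdot> r1"
    using pb unfolding pullback_square_def by blast
  have lift: "contraction_lift C A S r0 r1 c \<in> hom2 C (id1 C A) S"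
    "r0 \<cdot> contraction_lift C A S r0 r1 c = c" "r1 \<cdot> contraction_lift C A S r0 r1 c = c"
  proof -
    have "\<exists>!x. x \<in> hom2 C (id1 C A) S \<and> r0 \<cdot> x = c \<and> r1 \<cdot> x = c"
      using pullback_square_pair[OF pb r e I_in c(1) c(1)] c(2,3) by simp
    from theI'[OF this] show "contraction_lift C A S r0 r1 c \<in> hom2 C (id1 C A) S"
      "r0 \<cdot> contraction_lift C A S r0 r1 c = c" "r1 \<cdot> contraction_lift C A S r0 r1 c = c"
      unfolding contraction_lift_def by blast+
  qed
  show ?thesis
  proof
    fix x y z t :: 'm and f g h
    show "f \<in> hom2 C x y \<Longrightarrow> g \<in> hom2 C y z \<Longrightarrow> g \<cdot> f \<in> hom2 C x z"
      by (rule vcomp_hom)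
    show "f \<in> hom2 C t x \<Longrightarrow> g \<in> hom2 C x y \<Longrightarrow> h \<in> hom2 C y z \<Longrightarrow> h \<cdot> g \<cdot> f = h \<cdot> (g \<cdot> f)"
      by (rule vcomp_assoc)
    show "f \<in> hom2 C x y \<Longrightarrow> id2 C y \<cdot> f = f" by (rule vcomp_id_left)
    show "f \<in> hom2 C x y \<Longrightarrow> f \<cdot> id2 C x = f" by (rule vcomp_id_right)
    assume x: "x \<in> hom1 C T A"
    show "f \<in> hom2 C x y \<Longrightarrow> R \<rhd> f \<in> hom2 C (R \<odot> x) (R \<odot> y)" if "y \<in> hom1 C T A"
      using whisker_in[OF R_in x that] .
    show "f \<in> hom2 C x y \<Longrightarrow> g \<in> hom2 C y z \<Longrightarrow> R \<rhd> (g \<cdot> f) = (R \<rhd> g) \<cdot> (R \<rhd> f)"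
      if "y \<in> hom1 C T A" "z \<in> hom1 C T A"
      using whisker_comp[OF R_in x] .
    show "(e0 \<lhd> y) \<cdot> (R \<rhd> f) = f \<cdot> (e0 \<lhd> x)" "(e1 \<lhd> y) \<cdot> (R \<rhd> f) = f \<cdot> (e1 \<lhd> x)"
      if "y \<in> hom1 C T A" "f \<in> hom2 C x y"
      using evaluation_natural[OF R_in e(1) x that I_in] evaluation_natural[OF R_in e(2) x that I_in]
        whisker_id1[OF x that(2)] by simp_all
  next
    fix b assume b: "b \<in> hom1 C T A"
    note eval = evaluated_equation[OF _ _ _ _ b]
    note id_b = evaluation_id2[OF I_in b] comp1_id_left[OF b]
    note Rb = value_in[OF R_in b]
    show "R \<odot> b \<in> hom1 C T A" "S \<odot> b \<in> hom1 C T A" using value_in R_in S b by blast+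
    show "e0 \<lhd> b \<in> hom2 C (R \<odot> b) b" "e1 \<lhd> b \<in> hom2 C (R \<odot> b) b" by (rule e_at[OF b])+
    show "c \<lhd> b \<in> hom2 C b (R \<odot> b)" by (rule c_at[OF b])
    show "v \<lhd> b \<in> hom2 C (R \<odot> b) (R \<odot> b)" using evaluation_in[OF R_in R_in v(1) b] .
    show "(e0 \<lhd> b) \<cdot> (v \<lhd> b) = e1 \<lhd> b" using eval[OF R_in v(1) e(1) v(2)] .
    show "(e1 \<lhd> b) \<cdot> (v \<lhd> b) = e0 \<lhd> b" using eval[OF R_in v(1) e(2) v(3)] .
    show "(v \<lhd> b) \<cdot> (c \<lhd> b) = c \<lhd> b" using eval[OF I_in c(1) v(1) v(4)] .
    show "r0 \<lhd> b \<in> hom2 C (S \<odot> b) (R \<odot> b)" "r1 \<lhd> b \<in> hom2 C (S \<odot> b) (R \<odot> b)"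
      by (rule r_at[OF b])+
    show "s \<lhd> b \<in> hom2 C (S \<odot> b) (R \<odot> b)" using evaluation_in[OF S R_in s(1) b] .
    show "(e0 \<lhd> b) \<cdot> (s \<lhd> b) = (e0 \<lhd> b) \<cdot> (r1 \<lhd> b)"
      using eval[OF S s(1) e(1) s(2)] eval[OF S r(2) e(1) refl] by simp
    show "(e1 \<lhd> b) \<cdot> (s \<lhd> b) = (e1 \<lhd> b) \<cdot> (r0 \<lhd> b)"
      using eval[OF S s(1) e(2) s(3)] eval[OF S r(1) e(2) refl] by simp
    show "(e0 \<lhd> b) \<cdot> (r0 \<lhd> b) = (e1 \<lhd> b) \<cdot> (r1 \<lhd> b)"
      using eval[OF S r(1) e(1) square] eval[OF S r(2) e(2) refl] by simp
    show "\<exists>k \<in> hom2 C b (S \<odot> b).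
        (r0 \<lhd> b) \<cdot> k = c \<lhd> b \<and> (r1 \<lhd> b) \<cdot> k = c \<lhd> b \<and> (s \<lhd> b) \<cdot> k = c \<lhd> b"
    proof (intro bexI conjI)
      let ?k = "contraction_lift C A S r0 r1 c \<lhd> b"
      show "(r0 \<lhd> b) \<cdot> ?k = c \<lhd> b" using eval[OF I_in lift(1) r(1) lift(2)] .
      show "(r1 \<lhd> b) \<cdot> ?k = c \<lhd> b" using eval[OF I_in lift(1) r(2) lift(3)] .
      show "(s \<lhd> b) \<cdot> ?k = c \<lhd> b"
        using eval[OF I_in lift(1) s(1)] s_c unfolding subdivision_compatible_def by simp
      show "?k \<in> hom2 C b (S \<odot> b)"
        using evaluation_in[OF I_in S lift(1) b] id_b by simp
    qed
    show "\<Gamma> \<lhd> b \<in> hom2 C (R \<odot> b) (R \<odot> (R \<odot> b))"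
      using evaluation_in[OF R_in RR \<Gamma>(1) b] comp1_assoc[OF b R_in R_in] by simp
    show "(e0 \<lhd> (R \<odot> b)) \<cdot> (\<Gamma> \<lhd> b) = id2 C (R \<odot> b)"
      using eval[OF R_in \<Gamma>(1) eR(1) \<Gamma>(2)] evaluation_evaluation[OF R_in R_in e(1) b]
        evaluation_id2[OF R_in b] by simp
    show "(R \<rhd> (e0 \<lhd> b)) \<cdot> (\<Gamma> \<lhd> b) = id2 C (R \<odot> b)"
      using eval[OF R_in \<Gamma>(1) Re(1) \<Gamma>(3)] evaluation_whisker[OF R_in R_in e(1) b]
        evaluation_id2[OF R_in b] by simp
    show "(e1 \<lhd> (R \<odot> b)) \<cdot> (\<Gamma> \<lhd> b) = (c \<lhd> b) \<cdot> (e1 \<lhd> b)"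
      using eval[OF R_in \<Gamma>(1) eR(2) \<Gamma>(4)] evaluation_evaluation[OF R_in R_in e(2) b]
        eval[OF R_in e(2) c(1) refl] by simp
    show "(R \<rhd> (e1 \<lhd> b)) \<cdot> (\<Gamma> \<lhd> b) = (c \<lhd> b) \<cdot> (e1 \<lhd> b)"
      using eval[OF R_in \<Gamma>(1) Re(2) \<Gamma>(5)] evaluation_whisker[OF R_in R_in e(2) b]
        eval[OF R_in e(2) c(1) refl] by simp
    fix a u w assume a: "a \<in> hom1 C T A"
    show "\<exists>!k. k \<in> hom2 C a (S \<odot> b) \<and> (r0 \<lhd> b) \<cdot> k = u \<and> (r1 \<lhd> b) \<cdot> k = w"
      if "u \<in> hom2 C a (R \<odot> b)" "w \<in> hom2 C a (R \<odot> b)" "(e0 \<lhd> b) \<cdot> u = (e1 \<lhd> b) \<cdot> w"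
      using pullback_square_pair[OF pb_at[OF b] r_at[OF b] e_at[OF b] a that] .
    show "\<exists>k \<in> hom2 C a (R \<odot> (S \<odot> b)). (R \<rhd> (r0 \<lhd> b)) \<cdot> k = u \<and> (R \<rhd> (r1 \<lhd> b)) \<cdot> k = w"
      if "u \<in> hom2 C a (R \<odot> (R \<odot> b))" "w \<in> hom2 C a (R \<odot> (R \<odot> b))"
        "(R \<rhd> (e0 \<lhd> b)) \<cdot> u = (R \<rhd> (e1 \<lhd> b)) \<cdot> w"
      using right_adjoint_pair[OF pb_at[OF b] value_in[OF S b] Rb Rb b r_at[OF b] e_at[OF b] a that] .
  qed
qed

end

section \<open>Trivial cofibrations\<close>

theorem mainTheorem8:
  fixes C :: "('o, 'm, 'c) two_category"
    and T A :: 'o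
    and Cyl coCyl S a0 a1 :: 'm
    and i0 i1 p e0 e1 c v r0 r1 s \<Gamma> \<eta> \<epsilon> j :: 'c
  assumes "formal_category C T A"
    and "cylinder C A Cyl i0 i1"
    and "cyl_contraction C A Cyl i0 i1 p"
    and "cocylinder C A coCyl e0 e1"
    and "cocyl_contraction C A coCyl e0 e1 c"
    and "cocyl_involution C coCyl e0 e1 v"
    and "involution_compatible C v c"
    and "cocyl_subdivision C A coCyl e0 e1 S r0 r1 s"
    and "subdivision_compatible C A S r0 r1 s c"
    and "upper_left_connection C coCyl e0 e1 c \<Gamma>"
    and "cyl_left_adjoint C T A Cyl i0 i1 coCyl e0 e1 \<eta> \<epsilon>"
    and "adjunction_compatible C T A p coCyl c \<eta>"
    and "a0 \<in> hom1 C T A"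
    and "a1 \<in> hom1 C T A"
    and "j \<in> hom2 C a0 a1"
    and "trivial_cofibration C T A Cyl i0 i1 a0 a1 j"
  shows "strong_deformation_retraction C Cyl i0 i1 p a0 a1 j"
proof -
  interpret formal_category C T A by fact
  have adjunction: "adjunction C A A Cyl coCyl \<eta> \<epsilon>"
    using assms(11) unfolding cyl_left_adjoint_def by blast
  interpret cylinder_adjunction C T A Cyl coCyl \<eta> \<epsilon>
    by unfold_locales (rule adjunction)
  interpret path_category "hom1 C T A" "hom2 C" "vcomp C" "id2 C" "comp1 C coCyl"
    "whisker_left C coCyl" "whisker_right C e0" "whisker_right C e1" "whisker_right C c"
    "whisker_right C v" "comp1 C S" "whisker_right C r0" "whisker_right C r1" "whisker_right C s"
    "whisker_right C \<Gamma>"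
    by (rule evaluated_cocylinder) fact+
  note a0 = \<open>a0 \<in> hom1 C T A\<close> and a1 = \<open>a1 \<in> hom1 C T A\<close> and j = \<open>j \<in> hom2 C a0 a1\<close>
  have ends: "(e0 \<lhd>\<^bsub>C\<^esub> b) \<cdot>\<^bsub>C\<^esub> adj C coCyl \<eta> a h = h \<cdot>\<^bsub>C\<^esub> (i0 \<lhd>\<^bsub>C\<^esub> a)"
      "(e1 \<lhd>\<^bsub>C\<^esub> b) \<cdot>\<^bsub>C\<^esub> adj C coCyl \<eta> a h = h \<cdot>\<^bsub>C\<^esub> (i1 \<lhd>\<^bsub>C\<^esub> a)"
    if "a \<in> hom1 C T A" "b \<in> hom1 C T A" "h \<in> hom2 C (Cyl \<odot>\<^bsub>C\<^esub> a) b" for a b h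
    using assms(11) that unfolding cyl_left_adjoint_def by blast+
  have cof: "cofibration C T A Cyl i0 a0 a1 j"
    and equiv: "homotopy_equivalence C Cyl i0 i1 a0 a1 j"
    using assms(16) unfolding trivial_cofibration_def by blast+
  \<comment> \<open>Homotopy extension for the cylinder, transported along the adjunction to paths.\<close>
  have lifts: "lifts_paths a0 a1 j"
    unfolding lifts_paths_def
  proof (intro conjI ballI impI j)
    fix b f H assume b: "b \<in> hom1 C T A" and f: "f \<in> hom2 C a1 b"
      and H: "H \<in> hom2 C a0 (coCyl \<odot>\<^bsub>C\<^esub> b)" and eq: "(e0 \<lhd>\<^bsub>C\<^esub> b) \<cdot>\<^bsub>C\<^esub> H = f \<cdot>\<^bsub>C\<^esub> j"
    note h = transpose_in[OF a0 b H]
    have "transpose b H \<cdot>\<^bsub>C\<^esub> (i0 \<lhd>\<^bsub>C\<^esub> a0) = f \<cdot>\<^bsub>C\<^esub> j"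
      using ends(1)[OF a0 b h] adj_transpose[OF a0 b H] eq by simp
    then obtain k where k: "k \<in> hom2 C (Cyl \<odot>\<^bsub>C\<^esub> a1) b" "k \<cdot>\<^bsub>C\<^esub> (Cyl \<rhd>\<^bsub>C\<^esub> j) = transpose b H"
        "k \<cdot>\<^bsub>C\<^esub> (i0 \<lhd>\<^bsub>C\<^esub> a1) = f"
      using cof b f h unfolding cofibration_def by blast
    show "\<exists>K \<in> hom2 C a1 (coCyl \<odot>\<^bsub>C\<^esub> b). K \<cdot>\<^bsub>C\<^esub> j = H \<and> (e0 \<lhd>\<^bsub>C\<^esub> b) \<cdot>\<^bsub>C\<^esub> K = f"
    proof (intro bexI conjI)
      show "adj C coCyl \<eta> a1 k \<cdot>\<^bsub>C\<^esub> j = H"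
        using adj_precomp[OF a1 a0 b j k(1)] k(2) adj_transpose[OF a0 b H] by simp
      show "(e0 \<lhd>\<^bsub>C\<^esub> b) \<cdot>\<^bsub>C\<^esub> adj C coCyl \<eta> a1 k = f"
        using ends(1)[OF a1 b k(1)] k(3) by simp
      show "adj C coCyl \<eta> a1 k \<in> hom2 C a1 (coCyl \<odot>\<^bsub>C\<^esub> b)" using adj_in[OF a1 b k(1)] .
    qed
  qed
  obtain g h h' where g: "g \<in> hom2 C a1 a0"
    and h: "homotopy C Cyl i0 i1 a0 a0 (g \<cdot>\<^bsub>C\<^esub> j) (id2 C a0) h"
    and h': "homotopy C Cyl i0 i1 a1 a1 (j \<cdot>\<^bsub>C\<^esub> g) (id2 C a1) h'"
    using equiv unfolding homotopy_equivalence_def by blast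
  obtain f D where f: "f \<in> hom2 C a1 a0" "f \<cdot>\<^bsub>C\<^esub> j = id2 C a0"
    and D: "D \<in> hom2 C a1 (coCyl \<odot>\<^bsub>C\<^esub> a1)" "(e0 \<lhd>\<^bsub>C\<^esub> a1) \<cdot>\<^bsub>C\<^esub> D = j \<cdot>\<^bsub>C\<^esub> f"
      "(e1 \<lhd>\<^bsub>C\<^esub> a1) \<cdot>\<^bsub>C\<^esub> D = id2 C a1"
    using strict_retraction[OF a0 a1 lifts g, of "adj C coCyl \<eta> a0 h" "adj C coCyl \<eta> a1 h'"]
      adj_in[OF a0 a0, of h] adj_in[OF a1 a1, of h'] ends[OF a0 a0, of h] ends[OF a1 a1, of h'] h h'
    unfolding homotopy_def by auto
  \<comment> \<open>Transposing \<open>D'\<close> back gives the homotopy; compatibility of \<open>p\<close> with \<open>c\<close> makes it stationary on \<open>j\<close>.\<close>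
  obtain D' where D': "D' \<in> hom2 C a1 (coCyl \<odot>\<^bsub>C\<^esub> a1)" "(e0 \<lhd>\<^bsub>C\<^esub> a1) \<cdot>\<^bsub>C\<^esub> D' = j \<cdot>\<^bsub>C\<^esub> f"
      "(e1 \<lhd>\<^bsub>C\<^esub> a1) \<cdot>\<^bsub>C\<^esub> D' = id2 C a1" "D' \<cdot>\<^bsub>C\<^esub> j = (c \<lhd>\<^bsub>C\<^esub> a1) \<cdot>\<^bsub>C\<^esub> j"
    using rectify_deformation[OF a0 a1 lifts f D] .
  note k = transpose_in[OF a1 a1 D'(1)]
  have "homotopy C Cyl i0 i1 a1 a1 (j \<cdot>\<^bsub>C\<^esub> f) (id2 C a1) (transpose a1 D')"
    unfolding homotopy_def
    using k ends[OF a1 a1 k] adj_transpose[OF a1 a1 D'(1)] D' by simp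
  moreover have "transpose a1 D' \<cdot>\<^bsub>C\<^esub> (Cyl \<rhd>\<^bsub>C\<^esub> j) = j \<cdot>\<^bsub>C\<^esub> (p \<lhd>\<^bsub>C\<^esub> a0)"
  proof -
    have p: "p \<in> hom2 C Cyl (id1 C A)"
      using assms(3) unfolding cyl_contraction_def by blast
    have "p \<lhd>\<^bsub>C\<^esub> a0 \<in> hom2 C (Cyl \<odot>\<^bsub>C\<^esub> a0) a0"
      using evaluation_in[OF L_in I_in p a0] comp1_id_left[OF a0] by simp
    note jp = vcomp_hom[OF this j]
    have "transpose a1 D' \<cdot>\<^bsub>C\<^esub> (Cyl \<rhd>\<^bsub>C\<^esub> j) = transpose a1 ((c \<lhd>\<^bsub>C\<^esub> a1) \<cdot>\<^bsub>C\<^esub> j)"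
      using transpose_precomp[OF a1 a0 a1 j D'(1)] D'(4) by simp
    also have "\<dots> = transpose a1 (adj C coCyl \<eta> a0 (j \<cdot>\<^bsub>C\<^esub> (p \<lhd>\<^bsub>C\<^esub> a0)))"
      using assms(12) a0 a1 j unfolding adjunction_compatible_def by simp
    finally show ?thesis using transpose_adj[OF a0 a1 jp] by simp
  qed
  ultimately show ?thesis
    unfolding strong_deformation_retraction_def using f by blast
qed

end
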